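(* Let $n\geq 1$ be an integer, let $D\subset\mathbb{C}^n$ be an open subset, and let $f:=f_1+if_2:D\to\mathbb{C}$ be a holomorphic function, where $f_1,f_2:D\to\mathbb{R}$ are the real and imaginary parts of $f$. Then the following are equivalent: (i) $f$ is a complex Nash function on $D$. (ii) $f_1$ is a real Nash function on $D$ (with $D$ regarded as an open subset of $\mathbb{R}^{2n}$). (iii) $f_2$ is a real Nash function on $D$ (with $D$ regarded as an open subset of $\mathbb{R}^{2n}$).
   Context: Let $k$ be either $\mathbb{R}$ or $\mathbb{C}$, let $D\subset k^m$ be a (non-empty) open subset and $g:D\to k$ a function. The function $g$ is a $k$-Nash function at $x_0\in D$ if there exist an open neighbourhood $U$ of $x_0$ in $D$ and a non-zero polynomial $P\in k[x_1,\ldots,x_m,t]$ such that $g$ is $k$-analytic on $U$ (real analytic if $k=\mathbb{R}$, holomorphic if $k=\mathbb{C}$) and $P(x,g(x))=0$ for each $x\in U$. The function $g$ is a $k$-Nash function on $D$ if it is $k$-Nash at every point of $D$. $\mathbb{R}$-Nash functions are called real Nash functions and $\mathbb{C}$-Nash functions are called complex Nash functions. Note that the polynomial $P$ may depend on the point $x_0$, and $D$ is not assumed connected. $\mathbb{C}^n$ is identified with $\mathbb{R}^{2n}$ by $z=x+iy$, $x=(x_1,\ldots,x_n)$, $y=(y_1,\ldots,y_n)\in\mathbb{R}^n$. Thus $D\subset\mathbb{C}^n$ is also regarded as the open set $\{(x,y)\in\mathbb{R}^{2n}: x+iy\in D\}$, and the real-valued functions $f_1,f_2$ on $D$ are regarded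 as the functions $(x,y)\mapsto f_1(x+iy)$ and $(x,y)\mapsto f_2(x+iy)$ of $2n$ real variables. To say that $f_1$ or $f_2$ is a real Nash function on $D$ means that it is so as a function of these $2n$ real variables. *)

theory Defs
  imports "HOL-Analysis.Analysis" "HOL-Library.Poly_Mapping"
begin

text \<open>
  A polynomial with coefficients in \<open>'k\<close> and variables indexed by \<open>'v\<close> is a finitely supported
  map from exponent vectors to coefficients.
\<close>

type_synonym ('v, 'k) mpoly = "('v \<Rightarrow>\<^sub>0 nat) \<Rightarrow>\<^sub>0 'k"

definition mpoly_eval :: "('v, 'k::comm_ring_1) mpoly \<Rightarrow> ('v \<Rightarrow> 'k) \<Rightarrow> 'k"
  where "mpoly_eval P v =
    (\<Sum>m\<in>Poly_Mapping.keys P. Poly_Mapping.lookup P m *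
       (\<Prod>i\<in>Poly_Mapping.keys m. v i ^ Poly_Mapping.lookup m i))"

text \<open>
  The variables of a polynomial in \<open>k[x\<^sub>1, \<dots>, x\<^sub>m, t]\<close> are indexed by \<open>'m option\<close>:
  \<open>Some i\<close> stands for \<open>x\<^sub>i\<close> and \<open>None\<close> for \<open>t\<close>.
\<close>

definition graph_point :: "'k ^ 'm \<Rightarrow> 'k \<Rightarrow> 'm option \<Rightarrow> 'k"
  where "graph_point x t = (\<lambda>i. case i of None \<Rightarrow> t | Some j \<Rightarrow> x $ j)"

text \<open>
  Real analyticity: local expansion into a power series in several variables. Multi-indices are
  functions \<open>'m \<Rightarrow> nat\<close>; the sum over them is unconditional.
\<close>

definition real_analytic_on :: "(real ^ 'm::finite \<Rightarrow> real) \<Rightarrow> (real ^ 'm) set \<Rightarrow> bool"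
  where "real_analytic_on g U \<longleftrightarrow>
    (\<forall>a\<in>U. \<exists>r>0. \<exists>c :: ('m \<Rightarrow> nat) \<Rightarrow> real. ball a r \<subseteq> U \<and>
       (\<forall>x\<in>ball a r.
          ((\<lambda>\<alpha>. c \<alpha> * (\<Prod>i\<in>UNIV. (x $ i - a $ i) ^ \<alpha> i)) has_sum g x) UNIV))"

text \<open>
  Holomorphy in several variables: (total) complex differentiability at every point, i.e. the real
  Frechet derivative exists and is complex linear. Only meant for open \<open>U\<close>.
\<close>

definition holomorphic_several_on ::
    "(complex ^ 'n::finite \<Rightarrow> complex) \<Rightarrow> (complex ^ 'n) set \<Rightarrow> bool"
  where "holomorphic_several_on g U \<longleftrightarrow>
    (\<forall>z\<in>U. \<exists>L. (g has_derivative L) (at z within U) \<and> (\<forall>c v. L (c *s v) = c * L v))"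

text \<open>
  The first argument is the notion of \<open>k\<close>-analyticity; it is instantiated separately for the two
  fields below. The set \<open>U\<close> and the polynomial \<open>P\<close> may depend on \<open>x0\<close>.
\<close>

definition nash_at ::
    "(('k ^ 'm \<Rightarrow> 'k) \<Rightarrow> ('k ^ 'm) set \<Rightarrow> bool) \<Rightarrow>
     ('k::{comm_ring_1, topological_space} ^ 'm::finite \<Rightarrow> 'k) \<Rightarrow> ('k ^ 'm) set \<Rightarrow> 'k ^ 'm \<Rightarrow> bool"
  where "nash_at analytic g D x0 \<longleftrightarrow>
    (\<exists>U (P :: ('m option, 'k) mpoly).
       open U \<and> x0 \<in> U \<and> U \<subseteq> D \<and> P \<noteq> 0 \<and> analytic g U \<and>
       (\<forall>x\<in>U. mpoly_eval P (graph_point x (g x)) = 0))"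

definition real_nash_on :: "(real ^ 'm::finite \<Rightarrow> real) \<Rightarrow> (real ^ 'm) set \<Rightarrow> bool"
  where "real_nash_on g D \<longleftrightarrow> (\<forall>x0\<in>D. nash_at real_analytic_on g D x0)"

definition complex_nash_on :: "(complex ^ 'n::finite \<Rightarrow> complex) \<Rightarrow> (complex ^ 'n) set \<Rightarrow> bool"
  where "complex_nash_on g D \<longleftrightarrow> (\<forall>z0\<in>D. nash_at holomorphic_several_on g D z0)"

text \<open>
  The identification of \<open>\<real>\<^sup>2\<^sup>n\<close> with \<open>\<complex>\<^sup>n\<close>, \<open>(x, y) \<mapsto> x + iy\<close>: the coordinates \<open>Inl j\<close> are the
  \<open>x\<^sub>j\<close>, the coordinates \<open>Inr j\<close> are the \<open>y\<^sub>j\<close>.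
\<close>

definition complexify :: "real ^ ('n::finite + 'n) \<Rightarrow> complex ^ 'n"
  where "complexify v = (\<chi> j. Complex (v $ Inl j) (v $ Inr j))"

end

theory Submission
  imports Defs "HOL-Computational_Algebra.Field_as_Ring"
    "HOL-Computational_Algebra.Fundamental_Theorem_Algebra" "Subresultants.Subresultant_Gcd" "HOL-Complex_Analysis.Complex_Analysis"
begin

text \<open>
  If \<open>P (z, f z) = 0\<close>, then \<open>f\<close> and its complex conjugate both satisfy polynomial equations over
  \<open>\<complex>[x, y]\<close>; a resultant produces an equation for their sum \<open>2 Re f\<close>, whose real or imaginary part
  is a nonzero real equation. Conversely, let \<open>R (x, y, Re (f (x + iy))) = 0\<close>. Writing
  \<open>x = (z + w)/2\<close>, \<open>y = (z - w)/2i\<close> and \<open>Re f = (f z + cnj (f (cnj w)))/2\<close>, this identity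
  holds for \<open>w = cnj z\<close>, hence for all \<open>z\<close> and \<open>w\<close> by analytic continuation; freezing a generic \<open>w\<close>
  leaves an equation for \<open>f z\<close> over \<open>\<complex>[z]\<close>. The claim for the imaginary part follows by passing to
  \<open>-i f\<close>.
\<close>

text \<open>The overview passes over two obstacles. The first is analyticity: a real Nash function
  must have a convergent power series in 2n real variables, while holomorphy supplies only a complex
  derivative at each point. The expansion is obtained with one-variable function theory: the
  quotient (h t - h 0) / t stays holomorphic on the same disc of radius R, and its bound changes
  only by the factor 2/R. Dividing out one coordinate after another therefore yields Taylor
  coefficients with geometric control, and a quarter of the radius makes the ratio 1/2. The second
  is that the constructed equations must not be trivial. A polynomial is therefore carried as a
  function together with a point where it does not vanish.\<close>

no_notation fps_nth (infixl \<open>$\<close> 75)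
no_notation vec_index (infixl \<open>$\<close> 100)

section \<open>Polynomial functions\<close>

text \<open>Working with functions rather than formal polynomials makes substitution, determinants
  and conjugation plain closure properties. Being nonzero is expressed by a point where the function
  does not vanish.\<close>

inductive polyfun :: "(('v \<Rightarrow> 'k::comm_ring_1) \<Rightarrow> 'k) \<Rightarrow> bool" where
  polyfun_const: "polyfun (\<lambda>_. c)"
| polyfun_var: "polyfun (\<lambda>v. v i)"
| polyfun_add: "polyfun p \<Longrightarrow> polyfun q \<Longrightarrow> polyfun (\<lambda>v. p v + q v)"
| polyfun_mult: "polyfun p \<Longrightarrow> polyfun q \<Longrightarrow> polyfun (\<lambda>v. p v * q v)"

lemma polyfun_sum: "(\<And>i. i \<in> I \<Longrightarrow> polyfun (p i)) \<Longrightarrow> polyfun (\<lambda>v. \<Sum>i\<in>I. p i v)"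
  by (induction I rule: infinite_finite_induct) (auto intro: polyfun.intros)

lemma polyfun_prod: "(\<And>i. i \<in> I \<Longrightarrow> polyfun (p i)) \<Longrightarrow> polyfun (\<lambda>v. \<Prod>i\<in>I. p i v)"
  by (induction I rule: infinite_finite_induct) (auto intro: polyfun.intros)

lemma polyfun_power: "polyfun p \<Longrightarrow> polyfun (\<lambda>v. p v ^ k)"
  by (induction k) (auto intro: polyfun.intros)

lemma polyfun_minus: "polyfun p \<Longrightarrow> polyfun (\<lambda>v. - p v)"
  using polyfun_mult[OF polyfun_const[of "-1"]] by fastforce

lemma polyfun_diff: "polyfun p \<Longrightarrow> polyfun q \<Longrightarrow> polyfun (\<lambda>v. p v - q v)"
  using polyfun_add[OF _ polyfun_minus] by fastforce

lemma polyfun_if: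
  "(c \<Longrightarrow> polyfun p) \<Longrightarrow> (\<not> c \<Longrightarrow> polyfun q) \<Longrightarrow> polyfun (\<lambda>v. if c then p v else q v)"
  by (cases c) auto

lemma polyfun_subst:
  assumes "polyfun p" "\<And>i. polyfun (q i)"
  shows "polyfun (\<lambda>v. p (\<lambda>i. q i v))"
  using assms(1) by induction (auto intro: polyfun.intros assms(2))

lemma polyfun_divide:
  fixes p :: "('v \<Rightarrow> 'k::field) \<Rightarrow> 'k"
  shows "polyfun p \<Longrightarrow> polyfun (\<lambda>v. p v / c)"
  using polyfun_mult[OF _ polyfun_const[of "inverse c"]] by (fastforce simp: divide_inverse)

lemmas polyfun_intros = polyfun_const polyfun_var polyfun_add polyfun_mult polyfun_sum
  polyfun_prod polyfun_power polyfun_minus polyfun_diff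

section \<open>Formal polynomials and polynomial functions\<close>

definition monomial_eval :: "('v \<Rightarrow>\<^sub>0 nat) \<Rightarrow> ('v \<Rightarrow> 'k::comm_ring_1) \<Rightarrow> 'k" where
  "monomial_eval m v = (\<Prod>i\<in>Poly_Mapping.keys m. v i ^ Poly_Mapping.lookup m i)"

lemma mpoly_eval_alt:
  "mpoly_eval P v = (\<Sum>m\<in>Poly_Mapping.keys P. Poly_Mapping.lookup P m * monomial_eval m v)"
  by (simp add: mpoly_eval_def monomial_eval_def)

lemma monomial_eval_superset:
  assumes "finite S" "Poly_Mapping.keys m \<subseteq> S"
  shows "monomial_eval m v = (\<Prod>i\<in>S. v i ^ Poly_Mapping.lookup m i)"
  unfolding monomial_eval_def
  by (rule prod.mono_neutral_left) (use assms in \<open>auto simp: in_keys_iff\<close>)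

lemma mpoly_eval_superset:
  assumes "finite S" "Poly_Mapping.keys P \<subseteq> S"
  shows "mpoly_eval P v = (\<Sum>m\<in>S. Poly_Mapping.lookup P m * monomial_eval m v)"
  unfolding mpoly_eval_alt
  by (rule sum.mono_neutral_left) (use assms in \<open>auto simp: in_keys_iff\<close>)

lemma monomial_eval_add: "monomial_eval (m + m') v = monomial_eval m v * monomial_eval m' v"
proof -
  let ?S = "Poly_Mapping.keys m \<union> Poly_Mapping.keys m'"
  have "monomial_eval (m + m') v = (\<Prod>i\<in>?S. v i ^ Poly_Mapping.lookup (m + m') i)"
    by (rule monomial_eval_superset) (auto simp: Poly_Mapping.keys_add)
  also have "\<dots> = (\<Prod>i\<in>?S. v i ^ Poly_Mapping.lookup m i) * (\<Prod>i\<in>?S. v i ^ Poly_Mapping.lookup m' i)"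
    by (simp add: lookup_add power_add prod.distrib)
  also have "\<dots> = monomial_eval m v * monomial_eval m' v"
    by (subst (1 2) monomial_eval_superset[of ?S]) auto
  finally show ?thesis .
qed

lemma mpoly_eval_single: "mpoly_eval (Poly_Mapping.single m c) v = c * monomial_eval m v"
  by (subst mpoly_eval_superset[of "{m}"]) auto

lemma mpoly_eval_add: "mpoly_eval (P + Q) v = mpoly_eval P v + mpoly_eval Q v"
proof -
  let ?S = "Poly_Mapping.keys P \<union> Poly_Mapping.keys Q"
  have "mpoly_eval (P + Q) v = (\<Sum>m\<in>?S. Poly_Mapping.lookup (P + Q) m * monomial_eval m v)"
    by (rule mpoly_eval_superset) (auto simp: Poly_Mapping.keys_add)
  also have "\<dots> = (\<Sum>m\<in>?S. Poly_Mapping.lookup P m * monomial_eval m v)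
      + (\<Sum>m\<in>?S. Poly_Mapping.lookup Q m * monomial_eval m v)"
    by (simp add: lookup_add distrib_right sum.distrib)
  also have "\<dots> = mpoly_eval P v + mpoly_eval Q v"
    by (subst (1 2) mpoly_eval_superset[of ?S]) auto
  finally show ?thesis .
qed

text \<open>Meant for the product of two polynomials, whose terms are indexed by pairs of monomials.
  Different pairs may have the same exponent sum, so \<open>e\<close> may take a value
  repeatedly.\<close>

lemma mpoly_eval_sum_monomials:
  assumes "finite K"
  shows "\<exists>P. \<forall>v. mpoly_eval P v = (\<Sum>k\<in>K. c k * monomial_eval (e k) v)"
  using assms
proof (induction K rule: finite_induct)
  case empty
  show ?case by (rule exI[of _ 0]) (simp add: mpoly_eval_def)
next
  case (insert k K)
  then obtain P where "\<forall>v. mpoly_eval P v = (\<Sum>k\<in>K. c k * monomial_eval (e k) v)" by blast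
  then have "\<forall>v. mpoly_eval (Poly_Mapping.single (e k) (c k) + P) v
      = (\<Sum>k\<in>insert k K. c k * monomial_eval (e k) v)"
    using insert.hyps by (simp add: mpoly_eval_add mpoly_eval_single)
  then show ?case by blast
qed

lemma polyfun_imp_mpoly_eval: "polyfun p \<Longrightarrow> \<exists>P. \<forall>v. mpoly_eval P v = p v"
proof (induction rule: polyfun.induct)
  case (polyfun_const c)
  show ?case
    by (rule exI[of _ "Poly_Mapping.single 0 c"]) (simp add: mpoly_eval_single monomial_eval_def)
next
  case (polyfun_var i)
  show ?case
    by (rule exI[of _ "Poly_Mapping.single (Poly_Mapping.single i 1) 1"])
      (simp add: mpoly_eval_single monomial_eval_def)
next
  case (polyfun_add p q)
  then obtain P Q where "\<forall>v. mpoly_eval P v = p v" "\<forall>v. mpoly_eval Q v = q v" by blast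
  then show ?case by (intro exI[of _ "P + Q"]) (simp add: mpoly_eval_add)
next
  case (polyfun_mult p q)
  then obtain P Q where P: "\<forall>v. mpoly_eval P v = p v" and Q: "\<forall>v. mpoly_eval Q v = q v" by blast
  let ?K = "Poly_Mapping.keys P \<times> Poly_Mapping.keys Q"
  obtain R where R: "\<forall>v. mpoly_eval R v = (\<Sum>k\<in>?K.
      (Poly_Mapping.lookup P (fst k) * Poly_Mapping.lookup Q (snd k)) * monomial_eval (fst k + snd k) v)"
    using mpoly_eval_sum_monomials[of ?K "\<lambda>k. Poly_Mapping.lookup P (fst k) * Poly_Mapping.lookup Q (snd k)"
      "\<lambda>k. fst k + snd k"] by auto
  have "mpoly_eval R v = p v * q v" for v
  proof -
    have "p v * q v = mpoly_eval P v * mpoly_eval Q v" using P Q by simp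
    also have "\<dots> = mpoly_eval R v"
      unfolding R[rule_format] unfolding mpoly_eval_alt sum_product sum.cartesian_product
      by (rule sum.cong) (auto simp: monomial_eval_add mult_ac)
    finally show ?thesis by simp
  qed
  then show ?case by blast
qed

lemma polyfun_mpoly_eval: "polyfun (mpoly_eval P)"
proof -
  have "polyfun (\<lambda>v. mpoly_eval P v)"
    unfolding mpoly_eval_def by (intro polyfun_intros)
  then show ?thesis by simp
qed

text \<open>Induction on the variables: with the others fixed, the sum is a polynomial in
  \<open>v i\<close> that vanishes on an infinite field, so each of its coefficients vanishes. The
  abstract index set \<open>K\<close> lets the induction hypothesis apply to the monomials sharing
  one exponent of \<open>i\<close>, which the variables in \<open>S\<close> still separate.\<close>

lemma monomials_independent:
  fixes c :: "'b \<Rightarrow> 'k::field_char_0" and e :: "'b \<Rightarrow> 'v \<Rightarrow> nat"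
  assumes "finite S" "finite K"
    and "\<And>m m'. m \<in> K \<Longrightarrow> m' \<in> K \<Longrightarrow> (\<forall>j\<in>S. e m j = e m' j) \<Longrightarrow> m = m'"
    and "\<And>v. (\<Sum>m\<in>K. c m * (\<Prod>j\<in>S. v j ^ e m j)) = 0"
    and "m \<in> K"
  shows "c m = 0"
  using assms
proof (induction S arbitrary: K m rule: finite_induct)
  case empty
  then have "K = {m}" by auto
  with empty.prems(3) show ?case by simp
next
  case (insert i S)
  let ?K = "{m' \<in> K. e m' i = e m i}"
  have "(\<Sum>m\<in>?K. c m * (\<Prod>j\<in>S. v j ^ e m j)) = 0" for v
  proof -
    define q where "q = (\<Sum>m\<in>K. monom (c m * (\<Prod>j\<in>S. v j ^ e m j)) (e m i))"
    have "poly q t = 0" for t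
    proof -
      have "poly q t = (\<Sum>m\<in>K. c m * (\<Prod>j\<in>S. v j ^ e m j) * t ^ e m i)"
        by (simp add: q_def poly_sum poly_monom)
      also have "\<dots> = (\<Sum>m\<in>K. c m * (\<Prod>j\<in>insert i S. (v(i := t)) j ^ e m j))"
      proof (rule sum.cong[OF refl])
        fix m
        have "(\<Prod>j\<in>S. (v(i := t)) j ^ e m j) = (\<Prod>j\<in>S. v j ^ e m j)"
          using insert.hyps by (intro prod.cong) auto
        then show "c m * (\<Prod>j\<in>S. v j ^ e m j) * t ^ e m i
            = c m * (\<Prod>j\<in>insert i S. (v(i := t)) j ^ e m j)"
          using insert.hyps by simp
      qed
      also have "\<dots> = 0" by (rule insert.prems(3))
      finally show ?thesis .
    qed
    then have "q = 0" using poly_all_0_iff_0 by blast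
    then have "coeff q (e m i) = 0" by simp
    then have "(\<Sum>m'\<in>K. if e m' i = e m i then c m' * (\<Prod>j\<in>S. v j ^ e m' j) else 0) = 0"
      by (simp add: q_def coeff_sum)
    then show ?thesis using insert.prems(1) by (simp add: sum.inter_filter)
  qed
  moreover have "m1 = m2" if "m1 \<in> ?K" "m2 \<in> ?K" "\<forall>j\<in>S. e m1 j = e m2 j" for m1 m2
    using that insert.prems(2)[of m1 m2] by auto
  ultimately show ?case using insert.IH[of ?K m] insert.prems(1,4) by auto
qed

lemma mpoly_eval_nonzero:
  fixes P :: "('v::finite, 'k::field_char_0) mpoly"
  assumes "P \<noteq> 0"
  shows "\<exists>v. mpoly_eval P v \<noteq> 0"
proof (rule ccontr)
  assume "\<nexists>v. mpoly_eval P v \<noteq> 0"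
  then have 0: "(\<Sum>m\<in>Poly_Mapping.keys P.
      Poly_Mapping.lookup P m * (\<Prod>j\<in>UNIV. v j ^ Poly_Mapping.lookup m j)) = 0" for v
    unfolding mpoly_eval_alt by (simp add: monomial_eval_superset[of UNIV])
  from assms obtain m where m: "m \<in> Poly_Mapping.keys P"
    by fastforce
  have "Poly_Mapping.lookup P m = 0"
    by (rule monomials_independent[OF _ _ _ 0 m]) (auto simp: poly_mapping_eqI)
  with m show False by (simp add: in_keys_iff)
qed

section \<open>Points where a polynomial function does not vanish\<close>

lemma polyfun_line:
  assumes "polyfun p"
  shows "\<exists>q. \<forall>t. p (\<lambda>i. a i + t * b i) = poly q t"
  using assms
proof induction
  case (polyfun_const c)
  show ?case by (rule exI[of _ "[:c:]"]) simp
next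
  case (polyfun_var i)
  show ?case by (rule exI[of _ "[:a i, b i:]"]) simp
next
  case (polyfun_add p q)
  then show ?case by (metis poly_add)
next
  case (polyfun_mult p q)
  then show ?case by (metis poly_mult)
qed

text \<open>The coordinates are moved into the sets \<open>X i\<close> one at a time; along each
  coordinate line the function is a nonzero univariate polynomial, which has only finitely many
  roots to avoid.\<close>

lemma polyfun_nonzero_in_box:
  fixes p :: "('v::finite \<Rightarrow> 'k::field_char_0) \<Rightarrow> 'k"
  assumes p: "polyfun p" and v: "p v \<noteq> 0" and X: "\<And>i. infinite (X i)"
  shows "\<exists>w. (\<forall>i. w i \<in> X i) \<and> p w \<noteq> 0"
proof -
  have "\<exists>w. (\<forall>i\<in>S. w i \<in> X i) \<and> p w \<noteq> 0" if "finite S" for S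
    using that
  proof induction
    case empty
    show ?case using v by blast
  next
    case (insert i S)
    then obtain w where w: "\<forall>i\<in>S. w i \<in> X i" "p w \<noteq> 0" by blast
    \<comment> \<open>The base point has \<open>i\<close>-th coordinate 0, so the parameter
      \<open>t\<close> is the new coordinate and \<open>t = w i\<close> gives back
      \<open>w\<close>.\<close>
    obtain q where q: "\<forall>t. p (\<lambda>j. (w(i := 0)) j + t * (if j = i then 1 else 0)) = poly q t"
      using polyfun_line[OF p, of "w(i := 0)" "\<lambda>j. if j = i then 1 else 0"] by auto
    have eq: "(\<lambda>j. (w(i := 0)) j + t * (if j = i then 1 else 0)) = w(i := t)" for t
      by auto
    have "poly q (w i) \<noteq> 0" using q[rule_format, of "w i"] w(2) unfolding eq by simp
    then have "finite {t. poly q t = 0}" by (intro poly_roots_finite) auto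
    then obtain t where "t \<in> X i" "poly q t \<noteq> 0"
      using X[of i] by (metis (mono_tags, lifting) finite_subset mem_Collect_eq subsetI)
    then have "(\<forall>j\<in>insert i S. (w(i := t)) j \<in> X j) \<and> p (w(i := t)) \<noteq> 0"
      using w(1) q[rule_format, of t] insert.hyps unfolding eq by auto
    then show ?case by blast
  qed
  from this[of UNIV] show ?thesis by simp
qed

text \<open>On the line joining \<open>v\<close> (parameter 0) to \<open>w\<close> (parameter 1)
  both functions become nonzero univariate polynomials, and these have a nonzero product.\<close>

lemma polyfun_mult_nonzero:
  fixes p q :: "('v \<Rightarrow> 'k::field_char_0) \<Rightarrow> 'k"
  assumes "polyfun p" "polyfun q" "p v \<noteq> 0" "q w \<noteq> 0"
  shows "\<exists>u. p u \<noteq> 0 \<and> q u \<noteq> 0"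
proof -
  obtain p' where p': "\<forall>t. p (\<lambda>i. v i + t * (w i - v i)) = poly p' t"
    using polyfun_line[OF assms(1), of v "\<lambda>i. w i - v i"] by blast
  obtain q' where q': "\<forall>t. q (\<lambda>i. v i + t * (w i - v i)) = poly q' t"
    using polyfun_line[OF assms(2), of v "\<lambda>i. w i - v i"] by blast
  have "p' \<noteq> 0" using p'[rule_format, of 0] assms(3) by auto
  moreover have "q' \<noteq> 0" using q'[rule_format, of 1] assms(4) by auto
  ultimately have "p' * q' \<noteq> 0" by simp
  then obtain t where "poly (p' * q') t \<noteq> 0" using poly_all_0_iff_0 by blast
  then show ?thesis using p' q' by (metis mult_eq_0_iff poly_mult)
qed

section \<open>Sums of algebraic functions\<close>

text \<open>Reads a polynomial function as a polynomial in the \<open>None\<close> variable. The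
  degree bound is uniform in \<open>v\<close> because the size of the Sylvester matrix must not vary
  with the point.\<close>

lemma polyfun_as_poly:
  fixes p :: "('w option \<Rightarrow> 'k::comm_ring_1) \<Rightarrow> 'k"
  assumes "polyfun p"
  shows "\<exists>F d. (\<forall>k. polyfun (\<lambda>v. coeff (F v) k)) \<and> (\<forall>v. degree (F v) \<le> d) \<and>
    (\<forall>v t. p (case_option t v) = poly (F v) t)"
  using assms
proof induction
  case (polyfun_const c)
  show ?case
    by (rule exI[of _ "\<lambda>_. [:c:]"], rule exI[of _ 0]) (auto intro: polyfun_intros)
next
  case (polyfun_var i)
  show ?case
  proof (cases i)
    case None
    then show ?thesis
      by (intro exI[of _ "\<lambda>_. [:0,1:]"] exI[of _ 1]) (auto intro: polyfun_intros)
  next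
    case (Some j)
    have "polyfun (\<lambda>v. coeff [:v j:] k)" for k
      by (cases k) (auto intro: polyfun_intros)
    then show ?thesis using Some
      by (intro exI[of _ "\<lambda>v. [:v j:]"] exI[of _ 0]) auto
  qed
next
  case (polyfun_add p q)
  then obtain F d G e where "\<forall>k. polyfun (\<lambda>v. coeff (F v) k)" "\<forall>v. degree (F v) \<le> d"
    "\<forall>v t. p (case_option t v) = poly (F v) t"
    "\<forall>k. polyfun (\<lambda>v. coeff (G v) k)" "\<forall>v. degree (G v) \<le> e"
    "\<forall>v t. q (case_option t v) = poly (G v) t" by blast
  then show ?case
    by (intro exI[of _ "\<lambda>v. F v + G v"] exI[of _ "max d e"])
      (auto intro!: polyfun_intros degree_add_le intro: le_max_iff_disj[THEN iffD2])
next
  case (polyfun_mult p q)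
  then obtain F d G e where *: "\<forall>k. polyfun (\<lambda>v. coeff (F v) k)" "\<forall>v. degree (F v) \<le> d"
    "\<forall>v t. p (case_option t v) = poly (F v) t"
    "\<forall>k. polyfun (\<lambda>v. coeff (G v) k)" "\<forall>v. degree (G v) \<le> e"
    "\<forall>v t. q (case_option t v) = poly (G v) t" by blast
  have "degree (F v * G v) \<le> d + e" for v
    by (rule order_trans[OF degree_mult_le]) (use * in \<open>auto intro: add_mono\<close>)
  moreover have "polyfun (\<lambda>v. coeff (F v * G v) k)" for k
    unfolding coeff_mult using * by (auto intro!: polyfun_intros)
  ultimately show ?case using *
    by (intro exI[of _ "\<lambda>v. F v * G v"] exI[of _ "d + e"]) auto
qed

text \<open>\<open>d\<close> is the generic degree in \<open>t\<close>: the largest exponent whose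
  coefficient is not identically zero. At special \<open>v\<close> the degree may still be
  smaller.\<close>

lemma polyfun_as_poly_leading:
  fixes p :: "('w option \<Rightarrow> 'k::comm_ring_1) \<Rightarrow> 'k"
  assumes "polyfun p" "p u \<noteq> 0"
  obtains F d v0 where "\<And>k. polyfun (\<lambda>v. coeff (F v) k)" "\<And>v. degree (F v) \<le> d"
    "\<And>v t. p (case_option t v) = poly (F v) t" "coeff (F v0) d \<noteq> 0"
proof -
  obtain F d where F: "\<forall>k. polyfun (\<lambda>v. coeff (F v) k)" "\<forall>v. degree (F v) \<le> d"
    "\<forall>v t. p (case_option t v) = poly (F v) t"
    using polyfun_as_poly[OF assms(1)] by blast
  define Q where "Q k \<longleftrightarrow> (\<exists>v. coeff (F v) k \<noteq> 0)" for k
  have bound: "Q k \<Longrightarrow> k \<le> d" for k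
    using F(2) le_degree unfolding Q_def by (meson order_trans)
  have u: "u = case_option (u None) (u \<circ> Some)"
    by (auto split: option.split)
  have "poly (F (u \<circ> Some)) (u None) \<noteq> 0"
    using assms(2) u F(3) by metis
  then have "F (u \<circ> Some) \<noteq> 0" by auto
  then have "Q (degree (F (u \<circ> Some)))"
    unfolding Q_def using leading_coeff_neq_0 by blast
  then have G: "Q (Greatest Q)" using bound by (rule GreatestI_nat)
  have "degree (F v) \<le> Greatest Q" for v
  proof (rule degree_le, safe)
    fix i assume "Greatest Q < i"
    then have "\<not> Q i" using Greatest_le_nat[of Q i d] bound by auto
    then show "coeff (F v) i = 0" unfolding Q_def by simp
  qed
  then show ?thesis using that[of F "Greatest Q"] F G unfolding Q_def by blast
qed

lemma polyfun_det:
  assumes "\<And>v. M v \<in> carrier_mat n n"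
    and "\<And>i j. i < n \<Longrightarrow> j < n \<Longrightarrow> polyfun (\<lambda>v. M v $$ (i, j))"
  shows "polyfun (\<lambda>v. Determinant.det (M v))"
proof -
  have "Determinant.det (M v) = (\<Sum>p\<in>{p. p permutes {0..<n}}. signof p * (\<Prod>i = 0..<n. M v $$ (i, p i)))"
    for v
    by (rule det_def') (use assms(1) in auto)
  moreover have "p i < n" if "p permutes {0..<n}" "i < n" for p i
    using permutes_in_image[OF that(1), of i] that(2) by simp
  ultimately show ?thesis
    using assms(2) by (auto intro!: polyfun_intros)
qed

text \<open>\<open>[:u None, -1:]\<close> is the polynomial s - t in t with s =
  \<open>u None\<close>, so this concerns G(v, s - t), expanded in powers of s - t.\<close>

lemma polyfun_coeff_pcompose:
  assumes "\<And>k. polyfun (\<lambda>v. coeff (G v) k)" "\<And>v. degree (G v) \<le> e"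
  shows "polyfun (\<lambda>u. coeff (pcompose (G (u \<circ> Some)) [:u None, -1:]) k)"
proof -
  have pw: "polyfun (\<lambda>u. coeff ([:u None, -1:] ^ i) k)" for i k
  proof (induction i arbitrary: k)
    case 0
    show ?case by (auto intro: polyfun_intros)
  next
    case (Suc i)
    have "polyfun (\<lambda>u. coeff [:u None, -1:] j)" for j
      by (cases j; cases "j - 1") (auto intro: polyfun_intros)
    with Suc show ?case unfolding power_Suc coeff_mult by (auto intro!: polyfun_intros)
  qed
  have G: "polyfun (\<lambda>u. coeff (G (u \<circ> Some)) k)" for k
    unfolding comp_def by (rule polyfun_subst[OF assms(1)]) (rule polyfun_var)
  have "pcompose (G v) r = (\<Sum>i\<le>e. Polynomial.smult (coeff (G v) i) (r ^ i))" for v r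
  proof -
    have "G v = (\<Sum>i\<le>e. monom (coeff (G v) i) i)"
      using poly_as_sum_of_monoms'[OF assms(2)] by simp
    then have "pcompose (G v) r = (\<Sum>i\<le>e. pcompose (monom (coeff (G v) i) i) r)"
      by (metis pcompose_sum)
    also have "\<dots> = (\<Sum>i\<le>e. Polynomial.smult (coeff (G v) i) (r ^ i))"
      by (intro sum.cong refl) (simp add: monom_altdef pcompose_smult pcompose_pCons pcompose_hom.hom_power)
    finally show ?thesis .
  qed
  then show ?thesis
    using pw G by (auto simp: coeff_sum intro!: polyfun_intros)
qed

lemma common_root_imp_degree_gcd:
  fixes p q :: "complex poly"
  assumes "poly p x = 0" "poly q x = 0" "p \<noteq> 0"
  shows "degree (gcd p q) \<noteq> 0"
proof -
  have "[:- x, 1:] dvd gcd p q" using assms by (simp add: poly_eq_0_iff_dvd)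
  then have "degree [:- x, 1:] \<le> degree (gcd p q)" using assms(3) by (intro dvd_imp_degree_le) auto
  then show ?thesis by simp
qed

text \<open>The witness is the resultant in \<open>t\<close> of \<open>P(v, t)\<close> and \<open>Q(v, s - t)\<close>, multiplied by the leading
  coefficients of \<open>P\<close> and \<open>Q\<close> in \<open>t\<close>, so that points \<open>v\<close> at which a degree drops need no attention.\<close>

lemma algebraic_sum:
  fixes P Q :: "('w option \<Rightarrow> complex) \<Rightarrow> complex"
  assumes P: "polyfun P" "P u1 \<noteq> 0" and Q: "polyfun Q" "Q u2 \<noteq> 0"
  obtains R u where "polyfun R" "R u \<noteq> 0"
    "\<And>v x y. P (case_option x v) = 0 \<Longrightarrow> Q (case_option y v) = 0 \<Longrightarrow> R (case_option (x + y) v) = 0"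
proof -
  obtain F d v1 where F: "\<And>k. polyfun (\<lambda>v. coeff (F v) k)" "\<And>v. degree (F v) \<le> d"
    "\<And>v t. P (case_option t v) = poly (F v) t" "coeff (F v1) d \<noteq> 0"
    using polyfun_as_poly_leading[OF P] by blast
  obtain G e v2 where G: "\<And>k. polyfun (\<lambda>v. coeff (G v) k)" "\<And>v. degree (G v) \<le> e"
    "\<And>v t. Q (case_option t v) = poly (G v) t" "coeff (G v2) e \<noteq> 0"
    using polyfun_as_poly_leading[OF Q] by blast
  define H where "H u = pcompose (G (u \<circ> Some)) [:u None, -1:]" for u :: "'w option \<Rightarrow> complex"
  \<comment> \<open>The fixed sizes \<open>d\<close> and \<open>e\<close> keep the entries
    polynomial in \<open>u\<close>; the determinant is the resultant wherever both leading
    coefficients are nonzero.\<close>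
  define M where "M u = sylvester_mat_sub d e (F (u \<circ> Some)) (H u)" for u
  define R where "R u = coeff (F (u \<circ> Some)) d * coeff (G (u \<circ> Some)) e * Determinant.det (M u)" for u
  have restr: "polyfun (\<lambda>u :: 'w option \<Rightarrow> complex. coeff (F (u \<circ> Some)) k)"
    "polyfun (\<lambda>u :: 'w option \<Rightarrow> complex. coeff (G (u \<circ> Some)) k)" for k
    unfolding comp_def
    by (rule polyfun_subst[OF F(1)], rule polyfun_var, rule polyfun_subst[OF G(1)], rule polyfun_var)
  have H: "polyfun (\<lambda>u. coeff (H u) k)" for k
    unfolding H_def by (rule polyfun_coeff_pcompose[OF G(1,2)])
  have "polyfun (\<lambda>u. M u $$ (i, j))" if "i < d + e" "j < d + e" for i j
    unfolding M_def sylvester_mat_sub_index[OF that]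
    using restr H by (intro polyfun_if polyfun_const) auto
  then have "polyfun (\<lambda>u. Determinant.det (M u))"
    by (intro polyfun_det[where n = "d + e"]) (auto simp: M_def)
  then have "polyfun R"
    unfolding R_def using restr by (intro polyfun_intros)
  have det_M: "Determinant.det (M u) = 0 \<longleftrightarrow> degree (gcd (F (u \<circ> Some)) (H u)) \<noteq> 0"
    if "coeff (F (u \<circ> Some)) d \<noteq> 0" "coeff (G (u \<circ> Some)) e \<noteq> 0" for u
  proof -
    have "degree (F (u \<circ> Some)) = d" "degree (G (u \<circ> Some)) = e"
      using F(2) G(2) that by (meson antisym le_degree)+
    moreover have "degree (H u) = e"
      using calculation unfolding H_def by (simp add: degree_pcompose)
    ultimately have "Determinant.det (M u) = resultant (F (u \<circ> Some)) (H u)"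
      by (simp add: M_def resultant_def sylvester_mat_def)
    then show ?thesis by (simp add: resultant_0_gcd)
  qed
  have some: "case_option s v \<circ> Some = v" for s and v :: "'w \<Rightarrow> complex" by auto
  have poly_H: "poly (H (case_option s v)) t = poly (G v) (s - t)" for s v t
    unfolding H_def some by (simp add: poly_pcompose)
  obtain v where v: "coeff (F v) d \<noteq> 0" "coeff (G v) e \<noteq> 0"
    using polyfun_mult_nonzero[of "\<lambda>v. coeff (F v) d" "\<lambda>v. coeff (G v) e" v1 v2] F(1,4) G(1,4) by blast
  \<comment> \<open>For such \<open>v\<close>, any \<open>s\<close> that is not a sum of a root of
    \<open>F v\<close> and a root of \<open>G v\<close> keeps the resultant nonzero: a common root t
    of \<open>F v\<close> and \<open>H\<close> would make s = t + (s - t) such a sum.\<close>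
  have "finite {t. poly (F v) t = 0}" "finite {t. poly (G v) t = 0}"
    using v by (auto intro!: poly_roots_finite)
  then have "finite ((\<lambda>z. fst z + snd z) ` ({t. poly (F v) t = 0} \<times> {t. poly (G v) t = 0}))"
    by (intro finite_imageI finite_cartesian_product)
  from ex_new_if_finite[OF infinite_UNIV_char_0 this]
  obtain s where s: "s \<notin> (\<lambda>z. fst z + snd z) ` ({t. poly (F v) t = 0} \<times> {t. poly (G v) t = 0})" ..
  have "degree (gcd (F v) (H (case_option s v))) = 0"
  proof (rule ccontr)
    assume "degree (gcd (F v) (H (case_option s v))) \<noteq> 0"
    then obtain t where "poly (gcd (F v) (H (case_option s v))) t = 0"
      using Fundamental_Theorem_Algebra.fundamental_theorem_of_algebra[of "gcd (F v) (H (case_option s v))"]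
      by (auto simp: constant_degree)
    then have "[:- t, 1:] dvd F v" "[:- t, 1:] dvd H (case_option s v)"
      by (auto simp: poly_eq_0_iff_dvd)
    then have "poly (F v) t = 0" "poly (H (case_option s v)) t = 0"
      by (auto simp: poly_eq_0_iff_dvd)
    then have "(t, s - t) \<in> {t. poly (F v) t = 0} \<times> {t. poly (G v) t = 0}" by (simp add: poly_H)
    then have "s \<in> (\<lambda>z. fst z + snd z) ` ({t. poly (F v) t = 0} \<times> {t. poly (G v) t = 0})"
      by (rule rev_image_eqI) simp
    with s show False by blast
  qed
  then have "R (case_option s v) \<noteq> 0"
    using det_M[of "case_option s v"] v unfolding R_def some by simp
  moreover have "R (case_option (x + y) v) = 0"
    if "P (case_option x v) = 0" "Q (case_option y v) = 0" for v x y
  proof (cases "coeff (F v) d \<noteq> 0 \<and> coeff (G v) e \<noteq> 0")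
    case True
    \<comment> \<open>The common root is \<open>x\<close>: with s = x + y, the value of
      \<open>H\<close> at x is that of \<open>G v\<close> at s - x = y.\<close>
    have "degree (gcd (F v) (H (case_option (x + y) v))) \<noteq> 0"
      using that True by (intro common_root_imp_degree_gcd[where x = x]) (auto simp: F(3) G(3) poly_H)
    then show ?thesis
      using det_M[of "case_option (x + y) v"] True unfolding R_def some by simp
  qed (auto simp: R_def some)
  ultimately show ?thesis using that[of R] \<open>polyfun R\<close> by blast
qed

section \<open>Conjugation, complexification and the functional form of the Nash condition\<close>

lemma polyfun_cnj:
  assumes "polyfun p"
  shows "polyfun (\<lambda>v. cnj (p (\<lambda>i. cnj (v i))))"
  using assms by induction (auto intro: polyfun_intros)

text \<open>The two claims are proved together because the real and imaginary parts of a product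
  involve both parts of each factor.\<close>

lemma polyfun_Re_Im_of_real:
  fixes p :: "('v \<Rightarrow> complex) \<Rightarrow> complex"
  assumes "polyfun p"
  shows "polyfun (\<lambda>v. Re (p (\<lambda>i. of_real (v i)))) \<and> polyfun (\<lambda>v. Im (p (\<lambda>i. of_real (v i))))"
  using assms by induction (auto intro: polyfun_intros)

lemma polyfun_complex_extension:
  fixes p :: "('v \<Rightarrow> real) \<Rightarrow> real"
  assumes "polyfun p"
  shows "\<exists>q :: ('v \<Rightarrow> complex) \<Rightarrow> complex. polyfun q \<and> (\<forall>v. q (\<lambda>i. of_real (v i)) = of_real (p v))"
  using assms
proof induction
  case (polyfun_const c)
  show ?case by (rule exI[of _ "\<lambda>_. of_real c"]) (auto intro: polyfun_intros)
next
  case (polyfun_var i)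
  show ?case by (rule exI[of _ "\<lambda>v. v i"]) (auto intro: polyfun_intros)
next
  case (polyfun_add p q)
  then obtain p' q' where "polyfun p'" "polyfun q'"
    "\<forall>v. p' (\<lambda>i. complex_of_real (v i)) = of_real (p v)" "\<forall>v. q' (\<lambda>i. complex_of_real (v i)) = of_real (q v)"
    by blast
  then show ?case by (intro exI[of _ "\<lambda>v. p' v + q' v"]) (auto intro: polyfun_intros)
next
  case (polyfun_mult p q)
  then obtain p' q' where "polyfun p'" "polyfun q'"
    "\<forall>v. p' (\<lambda>i. complex_of_real (v i)) = of_real (p v)" "\<forall>v. q' (\<lambda>i. complex_of_real (v i)) = of_real (q v)"
    by blast
  then show ?case by (intro exI[of _ "\<lambda>v. p' v * q' v"]) (auto intro: polyfun_intros)
qed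

text \<open>From here on the Nash condition is used in this form, for both fields at once: a
  polynomial function and a point witnessing that it is nonzero.\<close>

lemma nash_at_iff:
  fixes g :: "'k::{field_char_0, topological_space} ^ 'm::finite \<Rightarrow> 'k"
  shows "nash_at analytic g D x0 \<longleftrightarrow>
    (\<exists>U p u. open U \<and> x0 \<in> U \<and> U \<subseteq> D \<and> polyfun p \<and> p u \<noteq> 0 \<and> analytic g U \<and>
       (\<forall>x\<in>U. p (case_option (g x) (vec_nth x)) = 0))"
proof
  assume "nash_at analytic g D x0"
  then obtain U P where U: "open U" "x0 \<in> U" "U \<subseteq> D" "P \<noteq> 0" "analytic g U"
    "\<forall>x\<in>U. mpoly_eval P (graph_point x (g x)) = 0"
    unfolding nash_at_def by blast
  with mpoly_eval_nonzero[OF U(4)] polyfun_mpoly_eval[of P]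
  show "\<exists>U p u. open U \<and> x0 \<in> U \<and> U \<subseteq> D \<and> polyfun p \<and> p u \<noteq> 0 \<and> analytic g U \<and>
       (\<forall>x\<in>U. p (case_option (g x) (vec_nth x)) = 0)"
    unfolding graph_point_def by metis
next
  assume "\<exists>U p u. open U \<and> x0 \<in> U \<and> U \<subseteq> D \<and> polyfun p \<and> p u \<noteq> 0 \<and> analytic g U \<and>
       (\<forall>x\<in>U. p (case_option (g x) (vec_nth x)) = 0)"
  then obtain U p u where U: "open U" "x0 \<in> U" "U \<subseteq> D" "polyfun p" "p u \<noteq> 0" "analytic g U"
    "\<forall>x\<in>U. p (case_option (g x) (vec_nth x)) = 0"
    by blast
  from polyfun_imp_mpoly_eval[OF U(4)] obtain P where P: "\<forall>v. mpoly_eval P v = p v" by blast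
  with U(5) have "P \<noteq> 0" by (auto simp: mpoly_eval_def)
  with U P show "nash_at analytic g D x0"
    unfolding nash_at_def graph_point_def by metis
qed

section \<open>Power series expansion of separately holomorphic functions\<close>

text \<open>The removable singularity at 0 is filled by the derivative, which keeps the quotient
  holomorphic.\<close>

definition diffquot :: "(complex \<Rightarrow> complex) \<Rightarrow> complex \<Rightarrow> complex" where
  "diffquot h t = (if t = 0 then deriv h 0 else (h t - h 0) / t)"

lemma diffquot_holomorphic:
  assumes "h holomorphic_on ball 0 R"
  shows "diffquot h holomorphic_on ball 0 R"
proof -
  have "diffquot h = (\<lambda>t. if t = 0 then deriv h 0 else (h t - h 0) / (t - 0))"
    by (auto simp: diffquot_def)
  then show ?thesis using pole_lemma_open[OF assms, of 0] by simp
qed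

text \<open>Maximum modulus principle: on the circle of radius \<rho> < R the quotient is at most
  2M/\<rho>. Since \<open>h\<close> is controlled only on the open disc, \<rho> tends to R at the
  end.\<close>

lemma diffquot_bound:
  assumes h: "h holomorphic_on ball 0 R"
    and M: "\<And>t. norm t < R \<Longrightarrow> norm (h t) \<le> M" and t: "norm t < R"
  shows "norm (diffquot h t) \<le> 2 * M / R"
proof -
  have bound: "norm (diffquot h t) \<le> 2 * M / \<rho>" if \<rho>: "norm t < \<rho>" "\<rho> < R" for \<rho>
  proof (rule maximum_modulus_frontier[where f = "diffquot h" and \<xi> = t and S = "cball 0 \<rho>"])
    have sub: "cball 0 \<rho> \<subseteq> ball 0 R" using \<rho> by auto
    note hol = holomorphic_on_subset[OF diffquot_holomorphic[OF h] sub]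
    show "diffquot h holomorphic_on interior (cball 0 \<rho>)"
      by (rule holomorphic_on_subset[OF hol]) (rule interior_subset)
    show "continuous_on (closure (cball 0 \<rho>)) (diffquot h)"
      using holomorphic_on_imp_continuous_on[OF hol] by simp
    show "t \<in> cball 0 \<rho>" using \<rho> by simp
    fix z :: complex assume "z \<in> frontier (cball 0 \<rho>)"
    then have z: "norm z = \<rho>" by simp
    have \<rho>0: "\<rho> > 0" using \<rho>(1) norm_ge_zero[of t] by linarith
    then have "norm (diffquot h z) = norm (h z - h 0) / \<rho>"
      using z by (auto simp: diffquot_def norm_divide)
    also have "norm (h z - h 0) \<le> M + M"
      using M[of z] M[of 0] z \<rho> \<rho>0 norm_triangle_ineq4[of "h z" "h 0"] by simp
    finally show "norm (diffquot h z) \<le> 2 * M / \<rho>"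
      using \<rho>0 by (simp add: divide_right_mono)
  qed simp
  have R: "R > 0" using t norm_ge_zero[of t] by linarith
  show ?thesis
  proof (rule tendsto_lowerbound)
    show "((\<lambda>\<rho>. 2 * M / \<rho>) \<longlongrightarrow> 2 * M / R) (at_left R)"
      using R by (intro tendsto_intros) auto
    show "\<forall>\<^sub>F \<rho> in at_left R. norm (diffquot h t) \<le> 2 * M / \<rho>"
      using bound eventually_at_left_real[OF t] by (auto elim!: eventually_mono)
  qed simp
qed

text \<open>The increment is t times the second quotient, and the bound of
  \<open>diffquot_bound\<close> applied twice gives 4M/R^2.\<close>

lemma diffquot_lipschitz:
  assumes h: "h holomorphic_on ball 0 R"
    and M: "\<And>t. norm t < R \<Longrightarrow> norm (h t) \<le> M" and t: "norm t < R"
  shows "norm (diffquot h t - diffquot h 0) \<le> 4 * M / R^2 * norm t"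
proof (cases "t = 0")
  case False
  have "norm (diffquot (diffquot h) t) \<le> 2 * (2 * M / R) / R"
    by (rule diffquot_bound[OF diffquot_holomorphic[OF h] diffquot_bound[OF h M] t])
  moreover have "diffquot h t - diffquot h 0 = diffquot (diffquot h) t * t"
    using False by (simp add: diffquot_def[of "diffquot h" t])
  ultimately have "norm (diffquot h t - diffquot h 0) \<le> 2 * (2 * M / R) / R * norm t"
    using mult_right_mono[OF _ norm_ge_zero[of t]] by (simp only: norm_mult)
  then show ?thesis by (simp add: power2_eq_square)
qed simp

definition coord_diffquot :: "'v \<Rightarrow> (('v \<Rightarrow> complex) \<Rightarrow> complex) \<Rightarrow> ('v \<Rightarrow> complex) \<Rightarrow> complex" where
  "coord_diffquot i H z = diffquot (\<lambda>t. H (z(i := t))) (z i)"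

text \<open>Separate holomorphy together with a uniform bound: these data pass from \<open>H\<close>
  to its difference quotients with the same \<open>R\<close>, so that the construction can be
  iterated.\<close>

definition sep_holomorphic :: "'v set \<Rightarrow> real \<Rightarrow> real \<Rightarrow> (('v \<Rightarrow> complex) \<Rightarrow> complex) \<Rightarrow> bool" where
  "sep_holomorphic S R M H \<longleftrightarrow> (\<forall>z. (\<forall>j. norm (z j) < R) \<longrightarrow>
     norm (H z) \<le> M \<and> (\<forall>j\<in>S. (\<lambda>t. H (z(j := t))) holomorphic_on ball 0 R))"

lemma sep_holomorphicD:
  assumes "sep_holomorphic S R M H" "\<And>j. norm (z j) < R"
  shows "norm (H z) \<le> M" "j \<in> S \<Longrightarrow> (\<lambda>t. H (z(j := t))) holomorphic_on ball 0 R"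
  using assms by (auto simp: sep_holomorphic_def)

text \<open>Where \<open>z i = 0\<close> the quotient is a derivative in direction \<open>i\<close>; its holomorphy in the other
  variables follows because it is, by \<open>diffquot_lipschitz\<close>, a uniform limit of genuine quotients.\<close>

lemma coord_diffquot_holomorphic_other:
  assumes H: "sep_holomorphic S R M H" and i: "i \<in> S" and j: "j \<in> S" "j \<noteq> i"
    and z: "\<And>k. norm (z k) < R"
  shows "(\<lambda>t. coord_diffquot i H (z(j := t))) holomorphic_on ball 0 R"
proof -
  have R: "R > 0" using z[of undefined] norm_ge_zero[of "z undefined"] by linarith
  define q where "q s t = diffquot (\<lambda>u. H ((z(j := t))(i := u))) s" for s t
  have hol: "(\<lambda>t. H ((z(j := t))(i := s))) holomorphic_on ball 0 R" if "norm s < R" for s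
  proof -
    have "(\<lambda>t. H ((z(i := s))(j := t))) holomorphic_on ball 0 R"
      using that z by (intro sep_holomorphicD(2)[OF H _ j(1)]) auto
    moreover have "(z(i := s))(j := t) = (z(j := t))(i := s)" for t
      using j(2) by (auto simp: fun_upd_twist)
    ultimately show ?thesis by simp
  qed
  have q: "q s holomorphic_on ball 0 R" if "norm s < R" "s \<noteq> 0" for s
  proof -
    have "(\<lambda>t. (H ((z(j := t))(i := s)) - H ((z(j := t))(i := 0))) / s) holomorphic_on ball 0 R"
      using that R by (intro holomorphic_intros hol) auto
    then show ?thesis using that(2) unfolding q_def diffquot_def by simp
  qed
  have lip: "norm (q s t - q 0 t) \<le> 4 * M / R^2 * norm s" if "norm s < R" "norm t < R" for s t
    unfolding q_def
  proof (rule diffquot_lipschitz)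
    show "(\<lambda>u. H ((z(j := t))(i := u))) holomorphic_on ball 0 R"
      by (rule sep_holomorphicD(2)[OF H _ i]) (use that z in auto)
    show "norm (H ((z(j := t))(i := u))) \<le> M" if "norm u < R" for u
      by (rule sep_holomorphicD(1)[OF H]) (use that \<open>norm t < R\<close> z in auto)
  qed fact
  \<comment> \<open>Nonzero parameters tending to 0; the summand 2 keeps them inside the open disc
    already for n = 0.\<close>
  define s where "s n = complex_of_real (R / (real n + 2))" for n
  have nrm: "norm (s n) = R / (real n + 2)" for n
    unfolding s_def norm_of_real using R by auto
  have s: "norm (s n) < R" "s n \<noteq> 0" for n
  proof -
    show "norm (s n) < R" unfolding nrm using R by (simp add: divide_less_eq add_pos_nonneg)
    have "R / (real n + 2) > 0" using R by auto
    then show "s n \<noteq> 0" using nrm[of n] by auto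
  qed
  have "q 0 holomorphic_on ball 0 R"
  proof (rule holomorphic_uniform_sequence)
    show "q (s n) holomorphic_on ball 0 R" for n
      by (intro q s)
    fix x :: complex assume "x \<in> ball 0 R"
    then obtain d where d: "d > 0" "cball x d \<subseteq> ball 0 R"
      by (meson open_ball open_contains_cball)
    have "uniform_limit (cball x d) (\<lambda>n. q (s n)) (q 0) sequentially"
    proof (rule uniform_limitI)
      fix e :: real assume e: "e > 0"
      have "(\<lambda>n. 4 * M / R^2 * (R / (real n + 2))) \<longlonglongrightarrow> 0" by real_asymp
      then have "\<forall>\<^sub>F n in sequentially. 4 * M / R^2 * (R / (real n + 2)) < e"
        using e by (rule order_tendstoD)
      then show "\<forall>\<^sub>F n in sequentially. \<forall>t\<in>cball x d. dist (q (s n) t) (q 0 t) < e"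
      proof eventually_elim
        case (elim n)
        show ?case
        proof
          fix t assume "t \<in> cball x d"
          then have t: "norm t < R" using d(2) by (auto simp: subset_iff)
          show "dist (q (s n) t) (q 0 t) < e"
            using lip[OF s(1)[of n] t] elim unfolding nrm dist_norm by linarith
        qed
      qed
    qed
    with d show "\<exists>d>0. cball x d \<subseteq> ball 0 R \<and>
        uniform_limit (cball x d) (\<lambda>n. q (s n)) (q 0) sequentially" by blast
  qed simp
  with q z[of i] have "q (z i) holomorphic_on ball 0 R" by (cases "z i = 0") auto
  then show ?thesis using j(2) unfolding q_def coord_diffquot_def by simp
qed

lemma sep_holomorphic_coord_diffquot:
  assumes H: "sep_holomorphic S R M H" and i: "i \<in> S"
  shows "sep_holomorphic S R (2 * M / R) (coord_diffquot i H)"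
  unfolding sep_holomorphic_def
proof (intro allI impI conjI ballI)
  fix z :: "'a \<Rightarrow> complex" assume z: "\<forall>j. norm (z j) < R"
  have hol: "(\<lambda>t. H (z(i := t))) holomorphic_on ball 0 R"
    by (rule sep_holomorphicD(2)[OF H _ i]) (use z in auto)
  show "norm (coord_diffquot i H z) \<le> 2 * M / R"
    unfolding coord_diffquot_def
  proof (rule diffquot_bound[OF hol])
    show "norm (H (z(i := t))) \<le> M" if "norm t < R" for t
      by (rule sep_holomorphicD(1)[OF H]) (use z that in auto)
  qed (use z in blast)
  fix j assume j: "j \<in> S"
  show "(\<lambda>t. coord_diffquot i H (z(j := t))) holomorphic_on ball 0 R"
  proof (cases "j = i")
    case True
    then show ?thesis
      using diffquot_holomorphic[OF hol] by (simp add: coord_diffquot_def)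
  next
    case False
    then show ?thesis using coord_diffquot_holomorphic_other[OF H i j] z by blast
  qed
qed

text \<open>Each quotient costs the factor 2/R in the bound but nothing in the radius.\<close>

lemma sep_holomorphic_coord_diffquot_iterate:
  assumes "sep_holomorphic S R M H" "i \<in> S"
  shows "sep_holomorphic S R (M * (2 / R) ^ k) ((coord_diffquot i ^^ k) H)"
proof (induction k)
  case (Suc k)
  from sep_holomorphic_coord_diffquot[OF this assms(2)] show ?case
    by (simp add: mult_ac)
qed (use assms in simp)

lemma coord_diffquot_step:
  "H z = H (z(i := 0)) + z i * coord_diffquot i H z"
  by (cases "z i = 0") (auto simp: coord_diffquot_def diffquot_def fun_upd_idem)

text \<open>Taylor expansion in the coordinate \<open>i\<close> with an exact remainder, obtained by
  iterating \<open>coord_diffquot_step\<close>.\<close>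

lemma coord_diffquot_expansion:
  "H z = (\<Sum>k<N. (coord_diffquot i ^^ k) H (z(i := 0)) * z i ^ k) + z i ^ N * (coord_diffquot i ^^ N) H z"
proof (induction N)
  case (Suc N)
  then show ?case
    using coord_diffquot_step[of "(coord_diffquot i ^^ N) H" z i] by (simp add: algebra_simps del: fun_upd_apply)
qed simp

text \<open>In the polydisc of radius R/4 the bound M (2/R)^k meets (R/4)^k, leaving M (1/2)^k; this
  dominates the terms and sends the remainder to 0.\<close>

lemma coord_diffquot_has_sum:
  assumes H: "sep_holomorphic S R M H" and i: "i \<in> S" and R: "R > 0"
    and y: "\<And>j. norm (y j) < R / 4"
  shows "((\<lambda>k. (coord_diffquot i ^^ k) H (y(i := 0)) * y i ^ k) has_sum H y) UNIV"
proof (rule norm_summable_imp_has_sum)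
  note Hk = sep_holomorphic_coord_diffquot_iterate[OF H i]
  have "norm (y j) < R" for j using y[of j] R by linarith
  then have "norm (H y) \<le> M" by (rule sep_holomorphicD(1)[OF H])
  then have M0: "M \<ge> 0" using norm_ge_zero[of "H y"] by linarith
  have small: "norm (u j) < R" if "\<And>j. norm (u j) < R / 4" for u :: "'a \<Rightarrow> complex" and j
    using that[of j] R by linarith
  \<comment> \<open>Stated for an independent point \<open>u\<close>: the terms need
    \<open>u = y(i := 0)\<close>, the remainder \<open>u = y\<close>.\<close>
  have est: "norm ((coord_diffquot i ^^ k) H u * y i ^ k) \<le> M * (1/2) ^ k"
    if "\<And>j. norm (u j) < R / 4" for u k
  proof -
    have "norm ((coord_diffquot i ^^ k) H u) \<le> M * (2 / R) ^ k"
      by (rule sep_holomorphicD(1)[OF Hk]) (use that small in blast)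
    moreover have "norm (y i) ^ k \<le> (R / 4) ^ k"
      using y[of i] by (intro power_mono) auto
    ultimately have "norm ((coord_diffquot i ^^ k) H u * y i ^ k) \<le> (M * (2 / R) ^ k) * (R / 4) ^ k"
      unfolding norm_mult norm_power using M0 R by (intro mult_mono) auto
    also have "\<dots> = M * (1/2) ^ k"
      using R by (simp flip: power_mult_distrib add: mult.assoc)
    finally show ?thesis .
  qed
  have y0: "norm ((y(i := 0)) j) < R / 4" for j using y R by auto
  have geo: "summable (\<lambda>k. M * (1/2) ^ k)"
    by (intro summable_mult summable_geometric) auto
  show "summable (\<lambda>k. norm ((coord_diffquot i ^^ k) H (y(i := 0)) * y i ^ k))"
    by (rule summable_comparison_test[OF _ geo]) (use est[of "y(i := 0)", OF y0] in \<open>simp del: fun_upd_apply\<close>)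
  have "(\<lambda>N. y i ^ N * (coord_diffquot i ^^ N) H y) \<longlonglongrightarrow> 0"
  proof (rule Lim_null_comparison)
    show "\<forall>\<^sub>F N in sequentially. norm (y i ^ N * (coord_diffquot i ^^ N) H y) \<le> M * (1/2) ^ N"
      using est[OF y] by (auto simp: mult.commute)
    show "(\<lambda>N. M * (1/2) ^ N) \<longlonglongrightarrow> 0" using geo by (rule summable_LIMSEQ_zero)
  qed
  then have "(\<lambda>N. H y - y i ^ N * (coord_diffquot i ^^ N) H y) \<longlonglongrightarrow> H y - 0"
    by (intro tendsto_intros)
  moreover have "H y - y i ^ N * (coord_diffquot i ^^ N) H y
      = (\<Sum>k<N. (coord_diffquot i ^^ k) H (y(i := 0)) * y i ^ k)" for N
    using coord_diffquot_expansion[of H y i N] by (simp add: algebra_simps)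
  ultimately show "(\<lambda>k. (coord_diffquot i ^^ k) H (y(i := 0)) * y i ^ k) sums H y"
    unfolding sums_def by simp
qed

text \<open>Induction on \<open>S\<close>: expand in one coordinate, then expand the coefficient
  functions in the others. The bound on the sum of absolute values is part of the induction because
  it makes the resulting double series absolutely summable.\<close>

lemma sep_holomorphic_power_series:
  fixes H :: "('v \<Rightarrow> complex) \<Rightarrow> complex"
  assumes "finite S" "sep_holomorphic S R M H" "R > 0"
  defines "E \<equiv> {\<alpha> :: 'v \<Rightarrow> nat. \<forall>i. i \<notin> S \<longrightarrow> \<alpha> i = 0}"
  shows "\<exists>c. \<forall>z. (\<forall>j. norm (z j) < R / 4) \<longrightarrow>
    (\<lambda>\<alpha>. norm (c \<alpha> * (\<Prod>i\<in>S. z i ^ \<alpha> i))) summable_on E \<and>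
    (\<Sum>\<^sub>\<infinity>\<alpha>\<in>E. norm (c \<alpha> * (\<Prod>i\<in>S. z i ^ \<alpha> i))) \<le> M * 2 ^ card S \<and>
    ((\<lambda>\<alpha>. c \<alpha> * (\<Prod>i\<in>S. z i ^ \<alpha> i)) has_sum H (\<lambda>j. if j \<in> S then z j else 0)) E"
  using assms(1-3) unfolding E_def
proof (induction S arbitrary: H M rule: finite_induct)
  case empty
  have E: "{\<alpha> :: 'v \<Rightarrow> nat. \<forall>i. i \<notin> {} \<longrightarrow> \<alpha> i = 0} = {\<lambda>_. 0}" by auto
  have "norm (H (\<lambda>_. 0)) \<le> M"
    using sep_holomorphicD(1)[OF empty.prems(1), of "\<lambda>_. 0"] empty.prems(2) by simp
  then show ?case
    unfolding E by (intro exI[of _ "\<lambda>_. H (\<lambda>_. 0)"]) (auto intro!: has_sum_finiteI)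
next
  case (insert i S)
  define Q where "Q k = (coord_diffquot i ^^ k) H" for k
  define ES where "ES = {\<alpha> :: 'v \<Rightarrow> nat. \<forall>i. i \<notin> S \<longrightarrow> \<alpha> i = 0}"
  define EI where "EI = {\<alpha> :: 'v \<Rightarrow> nat. \<forall>j. j \<notin> insert i S \<longrightarrow> \<alpha> j = 0}"
  have R: "R > 0" by fact
  have "norm (H (\<lambda>_. 0)) \<le> M"
    using sep_holomorphicD(1)[OF insert.prems(1), of "\<lambda>_. 0"] R by simp
  then have M0: "M \<ge> 0" using norm_ge_zero order_trans by blast
  \<comment> \<open>The k-th Taylor coefficient in coordinate \<open>i\<close>, as a function of the
    remaining coordinates, to which the induction hypothesis applies.\<close>
  have "sep_holomorphic S R (M * (2 / R) ^ k) (\<lambda>z. Q k (z(i := 0)))" for k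
    unfolding sep_holomorphic_def
  proof (intro allI impI conjI ballI)
    have Qk: "sep_holomorphic (insert i S) R (M * (2 / R) ^ k) (Q k)"
      unfolding Q_def by (rule sep_holomorphic_coord_diffquot_iterate[OF insert.prems(1)]) simp
    fix z :: "'v \<Rightarrow> complex" assume z: "\<forall>j. norm (z j) < R"
    show "norm (Q k (z(i := 0))) \<le> M * (2 / R) ^ k"
      by (rule sep_holomorphicD(1)[OF Qk]) (use z R in auto)
    fix j assume j: "j \<in> S"
    have "(\<lambda>t. Q k ((z(i := 0))(j := t))) holomorphic_on ball 0 R"
      by (rule sep_holomorphicD(2)[OF Qk]) (use z R j in auto)
    moreover have "(z(i := 0))(j := t) = (z(j := t))(i := 0)" for t
      using j insert.hyps by (auto simp: fun_upd_twist)
    ultimately show "(\<lambda>t. Q k ((z(j := t))(i := 0))) holomorphic_on ball 0 R" by simp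
  qed
  from insert.IH[OF this R, folded ES_def] have "\<exists>c. \<forall>z. (\<forall>j. norm (z j) < R / 4) \<longrightarrow>
    (\<lambda>\<alpha>. norm (c \<alpha> * (\<Prod>i\<in>S. z i ^ \<alpha> i))) summable_on ES \<and>
    (\<Sum>\<^sub>\<infinity>\<alpha>\<in>ES. norm (c \<alpha> * (\<Prod>i\<in>S. z i ^ \<alpha> i))) \<le> M * (2 / R) ^ k * 2 ^ card S \<and>
    ((\<lambda>\<alpha>. c \<alpha> * (\<Prod>i\<in>S. z i ^ \<alpha> i)) has_sum Q k ((\<lambda>j. if j \<in> S then z j else 0)(i := 0))) ES" for k .
  then have "\<forall>k. \<exists>c. \<forall>z. (\<forall>j. norm (z j) < R / 4) \<longrightarrow>
    (\<lambda>\<alpha>. norm (c \<alpha> * (\<Prod>i\<in>S. z i ^ \<alpha> i))) summable_on ES \<and>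
    (\<Sum>\<^sub>\<infinity>\<alpha>\<in>ES. norm (c \<alpha> * (\<Prod>i\<in>S. z i ^ \<alpha> i))) \<le> M * (2 / R) ^ k * 2 ^ card S \<and>
    ((\<lambda>\<alpha>. c \<alpha> * (\<Prod>i\<in>S. z i ^ \<alpha> i)) has_sum Q k ((\<lambda>j. if j \<in> S then z j else 0)(i := 0))) ES" ..
  from choice[OF this] obtain c where c: "\<forall>k z. (\<forall>j. norm (z j) < R / 4) \<longrightarrow>
    (\<lambda>\<alpha>. norm (c k \<alpha> * (\<Prod>i\<in>S. z i ^ \<alpha> i))) summable_on ES \<and>
    (\<Sum>\<^sub>\<infinity>\<alpha>\<in>ES. norm (c k \<alpha> * (\<Prod>i\<in>S. z i ^ \<alpha> i))) \<le> M * (2 / R) ^ k * 2 ^ card S \<and>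
    ((\<lambda>\<alpha>. c k \<alpha> * (\<Prod>i\<in>S. z i ^ \<alpha> i)) has_sum Q k ((\<lambda>j. if j \<in> S then z j else 0)(i := 0))) ES" ..
  \<comment> \<open>The exponent of \<open>i\<close> selects the Taylor coefficient, the rest of
    \<alpha> its multi-index; \<open>g\<close> inverts this splitting.\<close>
  define d where "d \<alpha> = c (\<alpha> i) (\<alpha>(i := 0))" for \<alpha>
  define g :: "nat \<times> ('v \<Rightarrow> nat) \<Rightarrow> 'v \<Rightarrow> nat" where "g p = (snd p)(i := fst p)" for p
  have g: "bij_betw g (UNIV \<times> ES) EI"
  proof (rule bij_betwI[where g = "\<lambda>\<alpha>. (\<alpha> i, \<alpha>(i := 0))"])
    show "g \<in> UNIV \<times> ES \<rightarrow> EI" unfolding g_def ES_def EI_def by auto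
    show "(\<lambda>\<alpha>. (\<alpha> i, \<alpha>(i := 0))) \<in> EI \<rightarrow> UNIV \<times> ES" unfolding ES_def EI_def by auto
    show "(g p i, (g p)(i := 0)) = p" if "p \<in> UNIV \<times> ES" for p
      using that insert.hyps unfolding g_def ES_def by (cases p) (auto simp: fun_upd_idem)
    show "g (\<alpha> i, \<alpha>(i := 0)) = \<alpha>" for \<alpha> unfolding g_def by simp
  qed
  have dg: "d (g (k, \<beta>)) * (\<Prod>j\<in>insert i S. z j ^ g (k, \<beta>) j) = c k \<beta> * (\<Prod>j\<in>S. z j ^ \<beta> j) * z i ^ k"
    if "\<beta> \<in> ES" for k \<beta> and z :: "'v \<Rightarrow> complex"
  proof -
    have "(\<Prod>j\<in>S. z j ^ (\<beta>(i := k)) j) = (\<Prod>j\<in>S. z j ^ \<beta> j)"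
      using insert.hyps by (intro prod.cong) auto
    moreover have "\<beta>(i := 0) = \<beta>" using that insert.hyps unfolding ES_def by (auto simp: fun_upd_idem)
    ultimately show ?thesis using insert.hyps unfolding d_def g_def by simp
  qed
  have "(\<lambda>\<alpha>. norm (d \<alpha> * (\<Prod>j\<in>insert i S. z j ^ \<alpha> j))) summable_on EI \<and>
    (\<Sum>\<^sub>\<infinity>\<alpha>\<in>EI. norm (d \<alpha> * (\<Prod>j\<in>insert i S. z j ^ \<alpha> j))) \<le> M * 2 ^ card (insert i S) \<and>
    ((\<lambda>\<alpha>. d \<alpha> * (\<Prod>j\<in>insert i S. z j ^ \<alpha> j)) has_sum H (\<lambda>j. if j \<in> insert i S then z j else 0)) EI"
    if z: "\<forall>j. norm (z j) < R / 4" for z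
  proof -
    define f where "f p = c (fst p) (snd p) * (\<Prod>j\<in>S. z j ^ snd p j) * z i ^ fst p" for p
    define B where "B = M * 2 ^ card S"
    define T where "T k = (\<Sum>\<^sub>\<infinity>\<beta>\<in>ES. norm (f (k, \<beta>)))" for k
    note ck = c[THEN spec, THEN spec, THEN mp, OF z]
    have inner: "(\<lambda>\<beta>. norm (f (k, \<beta>))) summable_on ES" for k
      unfolding f_def fst_conv snd_conv norm_mult[of _ "z i ^ _"]
      by (rule summable_on_cmult_left) (use ck[of k] in blast)
    \<comment> \<open>The bound from the induction hypothesis times (R/4)^k again leaves (1/2)^k;
      summing over k doubles \<open>B\<close>, whence one factor 2 per coordinate.\<close>
    have T: "T k \<le> B * (1/2) ^ k" for k
    proof -
      have "T k = (\<Sum>\<^sub>\<infinity>\<beta>\<in>ES. norm (c k \<beta> * (\<Prod>j\<in>S. z j ^ \<beta> j))) * norm (z i) ^ k"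
        unfolding T_def f_def fst_conv snd_conv norm_mult[of _ "z i ^ _"] norm_power
        by (rule infsum_cmult_left) (use ck[of k] in blast)
      also have "\<dots> \<le> (M * (2 / R) ^ k * 2 ^ card S) * (R / 4) ^ k"
      proof (rule mult_mono)
        show "norm (z i) ^ k \<le> (R / 4) ^ k" using z by (intro power_mono) (auto intro: less_imp_le)
      qed (use ck[of k] M0 R in auto)
      also have "\<dots> = B * ((2 / R) ^ k * (R / 4) ^ k)" by (simp add: B_def)
      also have "\<dots> = B * (1/2) ^ k" using R by (simp flip: power_mult_distrib)
      finally show ?thesis .
    qed
    have T0: "T k \<ge> 0" for k unfolding T_def by (rule infsum_nonneg) simp
    have geo: "((\<lambda>k. B * (1/2) ^ k) has_sum B * 2) UNIV"
    proof -
      have "(\<lambda>k. (1/2) ^ k :: real) sums (1 / (1 - 1/2))" by (rule geometric_sums) simp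
      then have "((\<lambda>k. (1/2) ^ k :: real) has_sum 2) UNIV"
        by (intro norm_summable_imp_has_sum) (auto simp: norm_power)
      then show ?thesis by (rule has_sum_cmult_right)
    qed
    have Tsum: "T summable_on UNIV"
      by (rule summable_on_comparison_test[OF has_sum_imp_summable[OF geo]]) (use T T0 in auto)
    have abs: "(\<lambda>p. norm (f p)) summable_on UNIV \<times> ES"
      unfolding Infinite_Sum.abs_summable_on_Sigma_iff using inner Tsum T0
      by (auto simp: T_def[symmetric] abs_of_nonneg)
    have "(\<Sum>\<^sub>\<infinity>p\<in>UNIV \<times> ES. norm (f p)) = (\<Sum>\<^sub>\<infinity>k. T k)"
      unfolding T_def by (rule infsum_Sigma_banach[symmetric]) (rule abs)
    also have "\<dots> \<le> (\<Sum>\<^sub>\<infinity>k. B * (1/2) ^ k)"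
      by (rule infsum_mono[OF Tsum has_sum_imp_summable[OF geo]]) (rule T)
    also have "\<dots> = M * 2 ^ card (insert i S)"
      using infsumI[OF geo] insert.hyps by (simp add: B_def)
    finally have le: "(\<Sum>\<^sub>\<infinity>p\<in>UNIV \<times> ES. norm (f p)) \<le> M * 2 ^ card (insert i S)" .
    define y where "y j = (if j \<in> insert i S then z j else 0)" for j
    have "((\<lambda>\<beta>. f (k, \<beta>)) has_sum Q k (y(i := 0)) * y i ^ k) ES" for k
    proof -
      have "(\<lambda>j. if j \<in> S then z j else 0)(i := 0) = y(i := 0)" by (auto simp: y_def)
      then have "((\<lambda>\<beta>. c k \<beta> * (\<Prod>j\<in>S. z j ^ \<beta> j)) has_sum Q k (y(i := 0))) ES"
        using ck[of k] by simp
      from has_sum_cmult_left[OF this, of "z i ^ k"] show ?thesis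
        by (simp add: f_def y_def)
    qed
    \<comment> \<open>Summing first over \<open>ES\<close> and then over k gives the one-variable
      expansion of \<open>H y\<close>, which identifies the value of the double series.\<close>
    then have "((\<lambda>k. Q k (y(i := 0)) * y i ^ k) has_sum infsum f (UNIV \<times> ES)) UNIV"
      by (intro has_sum_SigmaD[where f = f]) (use abs in \<open>auto intro: has_sum_infsum Infinite_Sum.abs_summable_summable\<close>)
    moreover have "((\<lambda>k. Q k (y(i := 0)) * y i ^ k) has_sum H y) UNIV"
      unfolding Q_def
      by (rule coord_diffquot_has_sum[OF insert.prems(1) _ R]) (use z R in \<open>auto simp: y_def\<close>)
    ultimately have "infsum f (UNIV \<times> ES) = H y" using has_sum_unique by blast
    then have sum: "(f has_sum H y) (UNIV \<times> ES)"
      using abs by (metis Infinite_Sum.abs_summable_summable has_sum_infsum)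
    have fg: "f p = d (g p) * (\<Prod>j\<in>insert i S. z j ^ g p j)" if "p \<in> UNIV \<times> ES" for p
      using that dg by (cases p) (auto simp: f_def)
    have "(\<lambda>\<alpha>. norm (d \<alpha> * (\<Prod>j\<in>insert i S. z j ^ \<alpha> j))) summable_on EI"
      using abs fg by (subst summable_on_reindex_bij_betw[OF g, symmetric]) (simp cong: summable_on_cong)
    moreover have "(\<Sum>\<^sub>\<infinity>\<alpha>\<in>EI. norm (d \<alpha> * (\<Prod>j\<in>insert i S. z j ^ \<alpha> j))) \<le> M * 2 ^ card (insert i S)"
      using le fg by (subst infsum_reindex_bij_betw[OF g, symmetric]) (simp cong: infsum_cong)
    moreover have "((\<lambda>\<alpha>. d \<alpha> * (\<Prod>j\<in>insert i S. z j ^ \<alpha> j)) has_sum H y) EI"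
      using sum fg by (subst has_sum_reindex_bij_betw[OF g, symmetric]) (simp cong: has_sum_cong)
    ultimately show ?thesis unfolding y_def by blast
  qed
  then show ?case unfolding EI_def by blast
qed

section \<open>Real analyticity of the real part of a holomorphic function\<close>

text \<open>Chain rule along a complex line; complex linearity turns the derivative into
  multiplication by \<open>L (vec_lambda b)\<close>. This is the passage from several variables to
  one-variable function theory.\<close>

lemma holomorphic_several_line:
  fixes f :: "complex ^ 'n::finite \<Rightarrow> complex"
  assumes f: "holomorphic_several_on f D"
    and D: "\<And>t. t \<in> T \<Longrightarrow> (\<chi> j. a j + t * b j) \<in> D"
  shows "(\<lambda>t. f (\<chi> j. a j + t * b j)) holomorphic_on T"
  unfolding holomorphic_on_def field_differentiable_def has_field_derivative_def
proof
  fix t assume t: "t \<in> T"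
  define \<gamma> where "\<gamma> t = (\<chi> j. a j + t * b j)" for t
  obtain L where L: "(f has_derivative L) (at (\<gamma> t) within D)" "\<And>c v. L (c *s v) = c * L v"
    using f D[OF t] unfolding holomorphic_several_on_def \<gamma>_def by metis
  have "bounded_linear (\<lambda>t. \<chi> j. t * b j)"
    by (simp add: linear_conv_bounded_linear[symmetric] linear_iff Finite_Cartesian_Product.vec_eq_iff algebra_simps)
  then have "((\<lambda>t. vec_lambda a + (\<chi> j. t * b j)) has_derivative (\<lambda>t. 0 + (\<chi> j. t * b j))) (at t within T)"
    by (intro has_derivative_add has_derivative_const bounded_linear_imp_has_derivative)
  moreover have "(\<lambda>t. vec_lambda a + (\<chi> j. t * b j)) = \<gamma>"
    by (auto simp: \<gamma>_def Finite_Cartesian_Product.vec_eq_iff)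
  ultimately have "(\<gamma> has_derivative (\<lambda>t. \<chi> j. t * b j)) (at t within T)" by simp
  moreover have "(f has_derivative L) (at (\<gamma> t) within \<gamma> ` T)"
    by (rule has_derivative_subset[OF L(1)]) (use D in \<open>auto simp: \<gamma>_def\<close>)
  ultimately have "((\<lambda>t. f (\<gamma> t)) has_derivative (\<lambda>s. L (\<chi> j. s * b j))) (at t within T)"
    by (rule has_derivative_in_compose)
  moreover have "L (\<chi> j. s * b j) = L (vec_lambda b) * s" for s
    using L(2)[of s "vec_lambda b"] by (simp add: vector_scalar_mult_def mult.commute)
  ultimately show "\<exists>f'. ((\<lambda>t. f (\<chi> j. a j + t * b j)) has_derivative (*) f') (at t within T)"
    unfolding \<gamma>_def by auto
qed

text \<open>Extends \<open>complexify\<close> to complex values of the coordinates x and y, so that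
  f can be continued off the real points.\<close>

definition cpoint :: "('n + 'n \<Rightarrow> complex) \<Rightarrow> complex ^ 'n" where
  "cpoint \<xi> = (\<chi> j. \<xi> (Inl j) + \<i> * \<xi> (Inr j))"

lemma cpoint_of_real: "cpoint (\<lambda>k. of_real (v $ k)) = complexify v"
  by (simp add: cpoint_def complexify_def Complex_eq Finite_Cartesian_Product.vec_eq_iff)

lemma dist_cpoint:
  fixes \<xi> \<eta> :: "'n::finite + 'n \<Rightarrow> complex"
  assumes "\<And>k. norm (\<xi> k - \<eta> k) \<le> r"
  shows "dist (cpoint \<xi>) (cpoint \<eta>) \<le> 2 * real CARD('n) * r"
proof -
  have "dist (cpoint \<xi>) (cpoint \<eta>) \<le> (\<Sum>j\<in>UNIV. norm ((cpoint \<xi> - cpoint \<eta>) $ j))"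
    unfolding dist_norm norm_vec_def by (rule L2_set_le_sum) simp
  also have "\<dots> \<le> (\<Sum>j\<in>(UNIV :: 'n set). 2 * r)"
  proof (rule sum_mono)
    fix j :: 'n
    have "(cpoint \<xi> - cpoint \<eta>) $ j = (\<xi> (Inl j) - \<eta> (Inl j)) + \<i> * (\<xi> (Inr j) - \<eta> (Inr j))"
      by (simp add: cpoint_def algebra_simps)
    also have "norm \<dots> \<le> norm (\<xi> (Inl j) - \<eta> (Inl j)) + norm (\<i> * (\<xi> (Inr j) - \<eta> (Inr j)))"
      by (rule norm_triangle_ineq)
    also have "\<dots> \<le> 2 * r" using assms[of "Inl j"] assms[of "Inr j"] by (simp add: norm_mult)
    finally show "norm ((cpoint \<xi> - cpoint \<eta>) $ j) \<le> 2 * r" .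
  qed
  finally show ?thesis by simp
qed

lemma cpoint_ball:
  fixes z :: "complex ^ 'n::finite"
  assumes "\<delta> > 0"
  obtains R where "R > 0" "\<And>\<xi> \<eta>. (\<And>k. norm (\<xi> k - \<eta> k) < R) \<Longrightarrow> cpoint \<eta> = z \<Longrightarrow> cpoint \<xi> \<in> ball z \<delta>"
proof
  \<comment> \<open>The added 1 turns the weak inequality of \<open>dist_cpoint\<close> into a
    strict one.\<close>
  define R where "R = \<delta> / (2 * real CARD('n) + 1)"
  show R: "R > 0" using assms by (auto simp: R_def intro!: divide_pos_pos add_nonneg_pos)
  fix \<xi> \<eta> :: "'n + 'n \<Rightarrow> complex"
  assume \<xi>: "\<And>k. norm (\<xi> k - \<eta> k) < R" and \<eta>: "cpoint \<eta> = z"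
  have "dist (cpoint \<xi>) (cpoint \<eta>) \<le> 2 * real CARD('n) * R"
    by (rule dist_cpoint) (use \<xi> less_imp_le in blast)
  also have "\<dots> < (2 * real CARD('n) + 1) * R" using R by (simp add: algebra_simps)
  also have "\<dots> = \<delta>"
    unfolding R_def by (simp add: add_nonneg_eq_0_iff)
  finally show "cpoint \<xi> \<in> ball z \<delta>" by (simp add: \<eta> dist_commute)
qed

text \<open>Near a real point, f composed with \<open>cpoint\<close> is a bounded, separately
  holomorphic function of 2n complex variables. Its power series is restricted to real increments,
  where taking real parts affects only the coefficients.\<close>

lemma real_analytic_on_Re:
  fixes f :: "complex ^ 'n::finite \<Rightarrow> complex"
  assumes f: "holomorphic_several_on f D" and D: "open D"
    and V: "open V" "V \<subseteq> complexify -` D"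
  shows "real_analytic_on (\<lambda>v. Re (f (complexify v))) V"
  unfolding real_analytic_on_def
proof
  fix a assume a: "a \<in> V"
  define z0 where "z0 = complexify a"
  have z0: "z0 \<in> D" using a V(2) by (auto simp: z0_def)
  obtain \<delta>1 where \<delta>1: "\<delta>1 > 0" "ball z0 \<delta>1 \<subseteq> D" using D z0 open_contains_ball by blast
  \<comment> \<open>Continuity supplies the uniform bound required by
    \<open>sep_holomorphic\<close>; the margin 1 is arbitrary.\<close>
  have "continuous (at z0 within D) f"
    using f z0 has_derivative_continuous unfolding holomorphic_several_on_def by blast
  then obtain \<delta>2 where \<delta>2: "\<delta>2 > 0" "\<And>w. w \<in> D \<Longrightarrow> dist w z0 < \<delta>2 \<Longrightarrow> dist (f w) (f z0) < 1"
    unfolding continuous_within_eps_delta by (metis less_numeral_extra(1))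
  have bound: "w \<in> D \<and> norm (f w) \<le> norm (f z0) + 1" if "w \<in> ball z0 (min \<delta>1 \<delta>2)" for w
  proof -
    have w: "w \<in> D" using that \<delta>1(2) by auto
    have "dist (f w) (f z0) < 1" by (rule \<delta>2(2)[OF w]) (use that in \<open>simp add: dist_commute\<close>)
    then show ?thesis using w norm_triangle_ineq2[of "f w" "f z0"] by (simp add: dist_norm)
  qed
  obtain R where R: "R > 0"
    "\<And>\<xi> \<eta>. (\<And>k. norm (\<xi> k - \<eta> k) < R) \<Longrightarrow> cpoint \<eta> = z0 \<Longrightarrow> cpoint \<xi> \<in> ball z0 (min \<delta>1 \<delta>2)"
    using cpoint_ball[of "min \<delta>1 \<delta>2" z0] \<delta>1(1) \<delta>2(1) by auto
  define H where "H \<xi> = f (cpoint (\<lambda>k. of_real (a $ k) + \<xi> k))" for \<xi>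
  have in_ball: "cpoint (\<lambda>k. of_real (a $ k) + \<xi> k) \<in> ball z0 (min \<delta>1 \<delta>2)" if "\<And>k. norm (\<xi> k) < R" for \<xi>
    by (rule R(2)[where \<eta> = "\<lambda>k. of_real (a $ k)"]) (use that in \<open>auto simp: cpoint_of_real z0_def\<close>)
  have "sep_holomorphic UNIV R (norm (f z0) + 1) H"
    unfolding sep_holomorphic_def
  proof (intro allI impI conjI ballI)
    fix \<xi> :: "'n + 'n \<Rightarrow> complex" assume \<xi>: "\<forall>k. norm (\<xi> k) < R"
    show "norm (H \<xi>) \<le> norm (f z0) + 1"
      unfolding H_def using bound[OF in_ball[of \<xi>]] \<xi> by blast
    fix k
    define A where "A j = of_real (a $ Inl j) + (\<xi>(k := 0)) (Inl j)
      + \<i> * (of_real (a $ Inr j) + (\<xi>(k := 0)) (Inr j))" for j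
    define B :: "'n \<Rightarrow> complex" where "B j = (if Inl j = k then 1 else 0) + \<i> * (if Inr j = k then 1 else 0)" for j
    have line: "cpoint (\<lambda>l. of_real (a $ l) + (\<xi>(k := t)) l) = (\<chi> j. A j + t * B j)" for t
      by (auto simp: cpoint_def A_def B_def Finite_Cartesian_Product.vec_eq_iff algebra_simps)
    show "(\<lambda>t. H (\<xi>(k := t))) holomorphic_on ball 0 R"
      unfolding H_def line
    proof (rule holomorphic_several_line[OF f])
      fix t :: complex assume "t \<in> ball 0 R"
      then have "norm ((\<xi>(k := t)) l) < R" for l using \<xi> by auto
      from bound[OF in_ball[of "\<xi>(k := t)", OF this]] show "(\<chi> j. A j + t * B j) \<in> D" unfolding line by blast
    qed
  qed
  from sep_holomorphic_power_series[OF finite[of UNIV] this R(1)] obtain c where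
    c: "\<And>\<xi>. (\<forall>k. norm (\<xi> k) < R / 4) \<Longrightarrow> ((\<lambda>\<alpha>. c \<alpha> * (\<Prod>i\<in>UNIV. \<xi> i ^ \<alpha> i)) has_sum H \<xi>) UNIV"
    by auto
  obtain r where r: "r > 0" "ball a r \<subseteq> V" using V(1) a open_contains_ball by blast
  have "((\<lambda>\<alpha>. Re (c \<alpha>) * (\<Prod>i\<in>UNIV. (x $ i - a $ i) ^ \<alpha> i)) has_sum Re (f (complexify x))) UNIV"
    if x: "x \<in> ball a (min r (R / 4))" for x
  proof -
    have "norm (complex_of_real (x $ k - a $ k)) < R / 4" for k
    proof -
      have "\<bar>(x - a) $ k\<bar> \<le> norm (x - a)" by (rule component_le_norm_cart)
      also have "\<dots> < R / 4" using x by (simp add: dist_norm norm_minus_commute)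
      finally show ?thesis by (simp only: norm_of_real vector_minus_component)
    qed
    then have "((\<lambda>\<alpha>. c \<alpha> * (\<Prod>i\<in>UNIV. complex_of_real (x $ i - a $ i) ^ \<alpha> i)) has_sum
        H (\<lambda>i. of_real (x $ i - a $ i))) UNIV"
      by (intro c) blast
    moreover have "H (\<lambda>i. of_real (x $ i - a $ i)) = f (complexify x)"
      by (simp add: H_def cpoint_of_real)
    moreover have "Re (c \<alpha> * (\<Prod>i\<in>UNIV. complex_of_real (x $ i - a $ i) ^ \<alpha> i))
        = Re (c \<alpha>) * (\<Prod>i\<in>UNIV. (x $ i - a $ i) ^ \<alpha> i)" for \<alpha>
      by (simp flip: of_real_power of_real_prod of_real_diff)
    ultimately show ?thesis
      using has_sum_Re[of "\<lambda>\<alpha>. c \<alpha> * (\<Prod>i\<in>UNIV. complex_of_real (x $ i - a $ i) ^ \<alpha> i)"] by simp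
  qed
  then show "\<exists>r>0. \<exists>c. ball a r \<subseteq> V \<and> (\<forall>x\<in>ball a r.
      ((\<lambda>\<alpha>. c \<alpha> * (\<Prod>i\<in>UNIV. (x $ i - a $ i) ^ \<alpha> i)) has_sum Re (f (complexify x))) UNIV)"
    using r R(1) by (intro exI[of _ "min r (R / 4)"] conjI exI[of _ "\<lambda>\<alpha>. Re (c \<alpha>)"]) auto
qed

section \<open>From complex Nash functions to real Nash functions\<close>

lemma holomorphic_several_on_subset:
  "holomorphic_several_on f D \<Longrightarrow> U \<subseteq> D \<Longrightarrow> holomorphic_several_on f U"
  unfolding holomorphic_several_on_def by (meson has_derivative_subset subsetD)

lemma holomorphic_several_on_cmult:
  assumes "holomorphic_several_on f D"
  shows "holomorphic_several_on (\<lambda>z. c * f z) D"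
  unfolding holomorphic_several_on_def
proof
  fix z assume "z \<in> D"
  with assms obtain L where L: "(f has_derivative L) (at z within D)" "\<forall>a v. L (a *s v) = a * L v"
    unfolding holomorphic_several_on_def by blast
  have "((\<lambda>z. c * f z) has_derivative (\<lambda>v. c * L v)) (at z within D)"
    by (rule has_derivative_mult_right[OF L(1)])
  with L(2) show "\<exists>L. ((\<lambda>z. c * f z) has_derivative L) (at z within D) \<and> (\<forall>a v. L (a *s v) = a * L v)"
    by (intro exI[of _ "\<lambda>v. c * L v"]) (simp add: mult_ac)
qed

lemma real_analytic_on_cong:
  assumes "\<And>x. x \<in> U \<Longrightarrow> g x = h x" "real_analytic_on g U"
  shows "real_analytic_on h U"
  unfolding real_analytic_on_def
proof
  fix a assume a: "a \<in> U"
  from assms(2)[unfolded real_analytic_on_def, THEN bspec, OF a] obtain r c where r: "r > 0" "ball a r \<subseteq> U"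
    "\<forall>x\<in>ball a r. ((\<lambda>\<alpha>. c \<alpha> * (\<Prod>i\<in>UNIV. (x $ i - a $ i) ^ \<alpha> i)) has_sum g x) UNIV"
    by (elim exE conjE) (rule that)
  have "g x = h x" if "x \<in> ball a r" for x using assms(1) r(2) that by blast
  with r show "\<exists>r>0. \<exists>c. ball a r \<subseteq> U \<and>
      (\<forall>x\<in>ball a r. ((\<lambda>\<alpha>. c \<alpha> * (\<Prod>i\<in>UNIV. (x $ i - a $ i) ^ \<alpha> i)) has_sum h x) UNIV)"
    by (intro exI[of _ r] conjI exI[of _ c]) auto
qed

lemma open_complexify_vimage:
  fixes U :: "(complex ^ 'n::finite) set"
  assumes "open U"
  shows "open (complexify -` U)"
  using assms
proof (rule open_vimage)
  show "continuous_on UNIV (complexify :: real ^ ('n + 'n) \<Rightarrow> _)"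
    unfolding complexify_def Complex_eq by (intro continuous_intros)
qed

lemma complex_nash_imp_real_nash:
  fixes f :: "complex ^ 'n::finite \<Rightarrow> complex"
  assumes D: "open D" and f: "holomorphic_several_on f D"
    and f1: "\<And>z. z \<in> D \<Longrightarrow> f1 z = Re (f z)" and nash: "complex_nash_on f D"
  shows "real_nash_on (f1 \<circ> complexify) (complexify -` D)"
  unfolding real_nash_on_def
proof
  fix v0 assume "v0 \<in> complexify -` D"
  then have "nash_at holomorphic_several_on f D (complexify v0)"
    using nash by (simp add: complex_nash_on_def)
  then obtain U P u where U: "open U" "complexify v0 \<in> U" "U \<subseteq> D" "polyfun P" "P u \<noteq> 0"
    "\<forall>z\<in>U. P (case_option (f z) (vec_nth z)) = 0"
    unfolding nash_at_iff by blast
  define V where "V = complexify -` U"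
  define P1 where "P1 w = P (case_option (w None) (\<lambda>j. w (Some (Inl j)) + \<i> * w (Some (Inr j))))"
    for w :: "('n + 'n) option \<Rightarrow> complex"
  define P2 where "P2 w = cnj (P1 (\<lambda>i. cnj (w i)))" for w
  have P1: "polyfun P1"
    unfolding P1_def
  proof (rule polyfun_subst[OF U(4)])
    show "polyfun (\<lambda>w :: ('n + 'n) option \<Rightarrow> complex.
        case i of None \<Rightarrow> w None | Some j \<Rightarrow> w (Some (Inl j)) + \<i> * w (Some (Inr j)))" for i
      by (cases i) (auto intro!: polyfun_intros)
  qed
  have P2: "polyfun P2"
    unfolding P2_def by (rule polyfun_cnj[OF P1])
  define w1 :: "('n + 'n) option \<Rightarrow> complex" where
    "w1 = case_option (u None) (case_sum (\<lambda>j. u (Some j)) (\<lambda>j. 0))"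
  have "case_option (w1 None) (\<lambda>j. w1 (Some (Inl j)) + \<i> * w1 (Some (Inr j))) = u"
    by (auto simp: w1_def split: option.split)
  then have P1w: "P1 w1 \<noteq> 0" using U(5) by (simp add: P1_def)
  then have P2w: "P2 (\<lambda>i. cnj (w1 i)) \<noteq> 0" by (simp add: P2_def)
  obtain R w2 where R: "polyfun R" "R w2 \<noteq> 0"
    "\<And>v x y. P1 (case_option x v) = 0 \<Longrightarrow> P2 (case_option y v) = 0 \<Longrightarrow> R (case_option (x + y) v) = 0"
    using algebraic_sum[OF P1 P1w P2 P2w] by blast
  define R2 where "R2 w = R (case_option (2 * w None) (\<lambda>j. w (Some j)))" for w
  have R2: "polyfun R2"
    unfolding R2_def
  proof (rule polyfun_subst[OF R(1)])
    show "polyfun (\<lambda>w :: ('n + 'n) option \<Rightarrow> complex.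
        case i of None \<Rightarrow> 2 * w None | Some j \<Rightarrow> w (Some j))" for i
      by (cases i) (auto intro!: polyfun_intros)
  qed
  have "case_option (2 * (w2(None := w2 None / 2)) None) (\<lambda>j. (w2(None := w2 None / 2)) (Some j)) = w2"
    by (auto split: option.split)
  then have "R2 (w2(None := w2 None / 2)) \<noteq> 0" using R(2) by (simp only: R2_def) simp
  moreover have "infinite (range complex_of_real)"
    by (simp add: finite_image_iff infinite_UNIV_char_0 inj_of_real)
  ultimately obtain w where w: "\<forall>i. w i \<in> range complex_of_real" "R2 w \<noteq> 0"
    using polyfun_nonzero_in_box[OF R2, of _ "\<lambda>_. range complex_of_real"] by blast
  have "complex_of_real (Re (w i)) = w i" for i
    using w(1)[rule_format, of i] by (elim rangeE) simp
  then have "(\<lambda>i. complex_of_real (Re (w i))) = w" by (rule ext)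
  then have nz: "Re (R2 (\<lambda>i. of_real (Re (w i)))) \<noteq> 0 \<or> Im (R2 (\<lambda>i. of_real (Re (w i)))) \<noteq> 0"
    using w(2) by (simp add: complex_eq_iff)
  have zero: "R2 (\<lambda>i. of_real (case_option ((f1 \<circ> complexify) v) (vec_nth v) i)) = 0" if "v \<in> V" for v
  proof -
    define z where "z = complexify v"
    have z: "z \<in> U" using that by (simp add: V_def z_def)
    define r where "r j = complex_of_real (v $ j)" for j
    have "(\<lambda>j. r (Inl j) + \<i> * r (Inr j)) = vec_nth z"
      by (auto simp: r_def z_def complexify_def Complex_eq)
    then have 1: "P1 (case_option (f z) r) = 0"
      using U(6) z by (simp add: P1_def)
    have "(\<lambda>i. cnj (case_option (cnj (f z)) r i)) = case_option (f z) r"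
      by (auto simp: r_def split: option.split)
    with 1 have "P2 (case_option (cnj (f z)) r) = 0"
      by (simp add: P2_def)
    with 1 have "R (case_option (f z + cnj (f z)) r) = 0" by (rule R(3))
    moreover have "f z + cnj (f z) = 2 * of_real (f1 z)"
      using f1 z U(3) by (auto simp: complex_add_cnj)
    ultimately show ?thesis by (simp add: R2_def r_def[abs_def] z_def)
  qed
  have analytic: "real_analytic_on (f1 \<circ> complexify) V"
  proof (rule real_analytic_on_cong)
    show "real_analytic_on (\<lambda>v. Re (f (complexify v))) V"
      by (rule real_analytic_on_Re[OF f D])
        (use U(1,3) open_complexify_vimage in \<open>auto simp: V_def\<close>)
  qed (use U(3) f1 in \<open>auto simp: V_def\<close>)
  have V: "open V" "v0 \<in> V" "V \<subseteq> complexify -` D"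
    using U(1-3) open_complexify_vimage by (auto simp: V_def)
  obtain q where q: "polyfun q" "q (\<lambda>i. Re (w i)) \<noteq> 0"
    "\<forall>v\<in>V. q (case_option ((f1 \<circ> complexify) v) (vec_nth v)) = 0"
    using nz
  proof
    assume "Re (R2 (\<lambda>i. of_real (Re (w i)))) \<noteq> 0"
    then show thesis
      using polyfun_Re_Im_of_real[OF R2] by (intro that[of "\<lambda>v. Re (R2 (\<lambda>i. of_real (v i)))"]) (simp_all add: zero del: comp_apply)
  next
    assume "Im (R2 (\<lambda>i. of_real (Re (w i)))) \<noteq> 0"
    then show thesis
      using polyfun_Re_Im_of_real[OF R2] by (intro that[of "\<lambda>v. Im (R2 (\<lambda>i. of_real (v i)))"]) (simp_all add: zero del: comp_apply)
  qed
  then show "nash_at real_analytic_on (f1 \<circ> complexify) (complexify -` D) v0"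
    unfolding nash_at_iff using V analytic by blast
qed

section \<open>From real Nash functions to complex Nash functions\<close>

lemma polyfun_holomorphic:
  assumes "polyfun p" "\<And>i. (\<lambda>t. g t i) holomorphic_on T"
  shows "(\<lambda>t. p (g t)) holomorphic_on T"
  using assms(1) by induction (auto intro!: holomorphic_intros assms(2))

lemma holomorphic_eq_0_from_real:
  assumes h: "h holomorphic_on ball 0 2" and 0: "\<And>t. \<bar>t\<bar> < 2 \<Longrightarrow> h (of_real t) = 0"
  shows "h \<i> = 0"
proof (rule analytic_continuation[OF h, of "of_real ` {-2<..<2}" 0])
  show "(0::complex) islimpt of_real ` {-2<..<2}"
    unfolding islimpt_approachable
  proof (intro allI impI)
    fix e :: real assume e: "e > 0"
    define t where "t = min 1 (e / 2)"
    have t: "0 < t" "t < 2" "t < e" using e by (auto simp: t_def)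
    then show "\<exists>x'\<in>complex_of_real ` {-2<..<2}. x' \<noteq> 0 \<and> dist x' 0 < e"
      by (intro bexI[of _ "of_real t"]) auto
  qed
qed (use 0 in auto)

lemma real_box_subset_ball:
  fixes v0 :: "real ^ 'm::finite"
  assumes "\<delta> > 0"
  obtains \<epsilon> where "\<epsilon> > 0" "\<And>v. (\<And>k. \<bar>v $ k - v0 $ k\<bar> < \<epsilon>) \<Longrightarrow> v \<in> ball v0 \<delta>"
proof
  show "\<delta> / real CARD('m) > 0" using assms by simp
  fix v assume v: "\<And>k. \<bar>v $ k - v0 $ k\<bar> < \<delta> / real CARD('m)"
  have "norm (v - v0) \<le> (\<Sum>k\<in>UNIV. \<bar>(v - v0) $ k\<bar>)" by (rule norm_le_l1_cart)
  also have "\<dots> < real CARD('m) * (\<delta> / real CARD('m))"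
    by (rule sum_bounded_above_strict) (use v in auto)
  finally show "v \<in> ball v0 \<delta>" by (simp add: dist_norm norm_minus_commute)
qed

text \<open>Complexification of the identity \<open>p (x, y, Re (f (x + iy))) = 0\<close>: it persists for complex
  \<open>x, y\<close> near a real point once \<open>Re f\<close> is replaced by its holomorphic extension. Any such
  \<open>(x, y)\<close> is the value at \<open>\<lambda> = i\<close> of the line \<open>\<lambda> \<mapsto> Re (x, y) + \<lambda> Im (x, y)\<close>, which is real for
  real \<open>\<lambda>\<close>, so the identity theorem in one variable applies.\<close>

lemma complexified_identity:
  fixes f :: "complex ^ 'n::finite \<Rightarrow> complex" and p :: "(('n + 'n) option \<Rightarrow> complex) \<Rightarrow> complex"
    and v0 :: "real ^ ('n + 'n)"
  assumes f: "holomorphic_several_on f D" and p: "polyfun p"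
    and D: "\<And>\<xi>. (\<And>k. norm (\<xi> k - of_real (v0 $ k)) < \<epsilon>) \<Longrightarrow> cpoint \<xi> \<in> D"
    and 0: "\<And>v :: real ^ ('n + 'n). (\<And>k. \<bar>v $ k - v0 $ k\<bar> < \<epsilon>) \<Longrightarrow>
      p (case_option (of_real (Re (f (complexify v)))) (\<lambda>k. of_real (v $ k))) = 0"
    and \<xi>: "\<And>k. norm (\<xi> k - of_real (v0 $ k)) < \<epsilon> / 4"
  shows "p (case_option ((f (cpoint \<xi>) + cnj (f (cpoint (\<lambda>k. cnj (\<xi> k))))) / 2) \<xi>) = 0"
proof -
  define \<eta> where "\<eta> t k = of_real (Re (\<xi> k)) + t * of_real (Im (\<xi> k))" for t :: complex and k
  define \<Phi> where "\<Phi> t = p (case_option ((f (cpoint (\<eta> t)) + cnj (f (cpoint (\<eta> (cnj t))))) / 2) (\<eta> t))" for t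
  have \<eta>: "norm (\<eta> t k - of_real (v0 $ k)) < \<epsilon>" if "norm t < 2" for t k
  proof -
    have "\<eta> t k - of_real (v0 $ k) = of_real (Re (\<xi> k - of_real (v0 $ k))) + t * of_real (Im (\<xi> k - of_real (v0 $ k)))"
      by (simp add: \<eta>_def)
    also have "norm \<dots> \<le> \<bar>Re (\<xi> k - of_real (v0 $ k))\<bar> + norm t * \<bar>Im (\<xi> k - of_real (v0 $ k))\<bar>"
      by (rule order_trans[OF norm_triangle_ineq]) (simp only: norm_mult norm_of_real order_refl)
    also have "\<dots> \<le> norm (\<xi> k - of_real (v0 $ k)) + 2 * norm (\<xi> k - of_real (v0 $ k))"
      by (intro add_mono mult_mono abs_Re_le_cmod abs_Im_le_cmod) (use that in auto)
    also have "\<dots> < \<epsilon>" using \<xi>[of k] norm_ge_zero[of "\<xi> k - of_real (v0 $ k)"] by linarith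
    finally show ?thesis .
  qed
  have line: "cpoint (\<eta> t) = (\<chi> j. (of_real (Re (\<xi> (Inl j))) + \<i> * of_real (Re (\<xi> (Inr j))))
      + t * (of_real (Im (\<xi> (Inl j))) + \<i> * of_real (Im (\<xi> (Inr j)))))" for t
    by (simp add: cpoint_def \<eta>_def Finite_Cartesian_Product.vec_eq_iff algebra_simps)
  have hol: "(\<lambda>t. f (cpoint (\<eta> t))) holomorphic_on ball 0 2"
    unfolding line by (rule holomorphic_several_line[OF f]) (use D \<eta> in \<open>auto simp flip: line\<close>)
  have "x \<in> cnj ` ball 0 2" if "norm x < 2" for x
    by (rule image_eqI[of _ _ "cnj x"]) (use that in auto)
  then have "cnj ` ball 0 2 = ball 0 2" by auto
  then have "(cnj \<circ> (\<lambda>t. f (cpoint (\<eta> t))) \<circ> cnj) holomorphic_on ball 0 2"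
    using hol by (intro holomorphic_on_compose_cnj_cnj) auto
  then have hol': "(\<lambda>t. cnj (f (cpoint (\<eta> (cnj t))))) holomorphic_on ball 0 2"
    by (simp add: comp_def)
  have "\<Phi> holomorphic_on ball 0 2"
    unfolding \<Phi>_def
  proof (rule polyfun_holomorphic[OF p])
    fix i :: "('n + 'n) option"
    show "(\<lambda>t. case i of None \<Rightarrow> (f (cpoint (\<eta> t)) + cnj (f (cpoint (\<eta> (cnj t))))) / 2
        | Some k \<Rightarrow> \<eta> t k) holomorphic_on ball 0 2"
      by (cases i) (auto simp: \<eta>_def intro!: holomorphic_intros hol hol')
  qed
  moreover have "\<Phi> (of_real t) = 0" if t: "\<bar>t\<bar> < 2" for t
  proof -
    define v :: "real ^ ('n + 'n)" where "v = (\<chi> k. Re (\<xi> k) + t * Im (\<xi> k))"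
    have v: "\<eta> (of_real t) = (\<lambda>k. of_real (v $ k))" by (simp add: \<eta>_def v_def fun_eq_iff)
    have "\<bar>v $ k - v0 $ k\<bar> < \<epsilon>" for k
      using \<eta>[of "of_real t" k] t unfolding v by (simp only: norm_of_real flip: of_real_diff)
    then have "p (case_option (of_real (Re (f (complexify v)))) (\<lambda>k. of_real (v $ k))) = 0" by (rule 0)
    then show ?thesis
      by (simp add: \<Phi>_def v cpoint_of_real complex_add_cnj)
  qed
  ultimately have "\<Phi> \<i> = 0" by (rule holomorphic_eq_0_from_real)
  moreover have "\<eta> \<i> = \<xi>" "\<eta> (cnj \<i>) = (\<lambda>k. cnj (\<xi> k))"
    by (auto simp: \<eta>_def fun_eq_iff complex_eq_iff)
  ultimately show ?thesis by (simp add: \<Phi>_def)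
qed

lemma real_nash_imp_complex_nash:
  fixes f :: "complex ^ 'n::finite \<Rightarrow> complex"
  assumes D: "open D" and f: "holomorphic_several_on f D"
    and f1: "\<And>z. z \<in> D \<Longrightarrow> f1 z = Re (f z)"
    and nash: "real_nash_on (f1 \<circ> complexify) (complexify -` D)"
  shows "complex_nash_on f D"
  unfolding complex_nash_on_def
proof
  fix z0 assume z0: "z0 \<in> D"
  define v0 :: "real ^ ('n + 'n)" where
    "v0 = (\<chi> k. case k of Inl j \<Rightarrow> Re (z0 $ j) | Inr j \<Rightarrow> Im (z0 $ j))"
  have v0: "complexify v0 = z0" by (simp add: complexify_def v0_def Finite_Cartesian_Product.vec_eq_iff)
  with z0 nash have "nash_at real_analytic_on (f1 \<circ> complexify) (complexify -` D) v0"
    by (simp add: real_nash_on_def)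
  then obtain U p u where U: "open U" "v0 \<in> U" "U \<subseteq> complexify -` D" "polyfun p" "p u \<noteq> 0"
    "\<forall>v\<in>U. p (case_option ((f1 \<circ> complexify) v) (vec_nth v)) = 0"
    unfolding nash_at_iff by blast
  obtain \<delta>1 where \<delta>1: "\<delta>1 > 0" "ball v0 \<delta>1 \<subseteq> U" using U open_contains_ball by blast
  obtain \<epsilon>1 where \<epsilon>1: "\<epsilon>1 > 0" "\<And>v. (\<And>k. \<bar>v $ k - v0 $ k\<bar> < \<epsilon>1) \<Longrightarrow> v \<in> ball v0 \<delta>1"
    using real_box_subset_ball[OF \<delta>1(1)] by blast
  obtain \<delta>2 where \<delta>2: "\<delta>2 > 0" "ball z0 \<delta>2 \<subseteq> D" using D z0 open_contains_ball by blast
  obtain \<epsilon>2 where \<epsilon>2: "\<epsilon>2 > 0"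
    "\<And>\<xi> \<eta>. (\<And>k. norm (\<xi> k - \<eta> k) < \<epsilon>2) \<Longrightarrow> cpoint \<eta> = z0 \<Longrightarrow> cpoint \<xi> \<in> ball z0 \<delta>2"
    using cpoint_ball[OF \<delta>2(1), of z0] by blast
  define \<epsilon> where "\<epsilon> = min \<epsilon>1 \<epsilon>2"
  have \<epsilon>: "\<epsilon> > 0" "\<epsilon> \<le> \<epsilon>1" "\<epsilon> \<le> \<epsilon>2" using \<epsilon>1 \<epsilon>2 by (auto simp: \<epsilon>_def)
  obtain pc where pc: "polyfun pc" "\<And>v. pc (\<lambda>i. complex_of_real (v i)) = of_real (p v)"
    using polyfun_complex_extension[OF U(4)] by blast
  have ident: "pc (case_option ((f (cpoint \<xi>) + cnj (f (cpoint (\<lambda>k. cnj (\<xi> k))))) / 2) \<xi>) = 0"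
    if \<xi>: "\<And>k. norm (\<xi> k - of_real (v0 $ k)) < \<epsilon> / 4" for \<xi>
  proof (rule complexified_identity[OF f pc(1) _ _ \<xi>])
    fix \<zeta> :: "'n + 'n \<Rightarrow> complex" assume "\<And>k. norm (\<zeta> k - of_real (v0 $ k)) < \<epsilon>"
    then have "norm (\<zeta> k - of_real (v0 $ k)) < \<epsilon>2" for k using \<epsilon>(3) less_le_trans by blast
    then have "cpoint \<zeta> \<in> ball z0 \<delta>2"
      by (rule \<epsilon>2(2)) (simp add: cpoint_of_real v0)
    then show "cpoint \<zeta> \<in> D" using \<delta>2(2) by blast
  next
    fix v :: "real ^ ('n + 'n)" assume "\<And>k. \<bar>v $ k - v0 $ k\<bar> < \<epsilon>"
    then have "\<bar>v $ k - v0 $ k\<bar> < \<epsilon>1" for k using \<epsilon>(2) less_le_trans by blast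
    then have "v \<in> ball v0 \<delta>1" by (rule \<epsilon>1(2))
    then have v: "v \<in> U" using \<delta>1(2) by blast
    then have f1v: "f1 (complexify v) = Re (f (complexify v))" using f1 U(3) by blast
    have "case_option (complex_of_real (Re (f (complexify v)))) (\<lambda>k. of_real (v $ k))
        = (\<lambda>i. of_real (case_option (f1 (complexify v)) (vec_nth v) i))"
      by (auto simp: f1v split: option.split)
    then show "pc (case_option (of_real (Re (f (complexify v)))) (\<lambda>k. of_real (v $ k))) = 0"
      using U(6) v by (simp add: pc(2))
  qed
  define \<xi> where "\<xi> z w k = (case k of Inl j \<Rightarrow> (z j + w j) / 2 | Inr j \<Rightarrow> (z j - w j) / (2 * \<i>))"
    for z w :: "'n \<Rightarrow> complex" and k
  have \<xi>_near: "norm (\<xi> (vec_nth z) w k - of_real (v0 $ k)) < \<epsilon> / 4"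
    if z: "\<And>j. norm (z $ j - z0 $ j) < \<epsilon> / 4" and w: "\<And>j. norm (w j - cnj (z0 $ j)) < \<epsilon> / 4" for z w k
  proof (cases k)
    case (Inl j)
    have "of_real (v0 $ k) = (z0 $ j + cnj (z0 $ j)) / 2"
      by (simp add: v0_def Inl complex_add_cnj)
    then have "\<xi> (vec_nth z) w k - of_real (v0 $ k) = ((z $ j - z0 $ j) + (w j - cnj (z0 $ j))) / 2"
      by (simp add: \<xi>_def Inl field_simps)
    then have "norm (\<xi> (vec_nth z) w k - of_real (v0 $ k)) = norm ((z $ j - z0 $ j) + (w j - cnj (z0 $ j))) / 2"
      by (simp only: norm_divide) simp
    then show ?thesis using z[of j] w[of j] norm_triangle_ineq[of "z $ j - z0 $ j" "w j - cnj (z0 $ j)"]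
      by linarith
  next
    case (Inr j)
    have "of_real (v0 $ k) = (z0 $ j - cnj (z0 $ j)) / (2 * \<i>)"
      by (auto simp: v0_def Inr complex_eq_iff Re_divide Im_divide)
    then have "\<xi> (vec_nth z) w k - of_real (v0 $ k) = ((z $ j - z0 $ j) - (w j - cnj (z0 $ j))) / (2 * \<i>)"
      unfolding \<xi>_def Inr by (simp add: algebra_simps flip: diff_divide_distrib)
    then have "norm (\<xi> (vec_nth z) w k - of_real (v0 $ k)) = norm ((z $ j - z0 $ j) - (w j - cnj (z0 $ j))) / 2"
      by (simp only: norm_divide norm_mult) simp
    then show ?thesis using z[of j] w[of j] norm_triangle_ineq4[of "z $ j - z0 $ j" "w j - cnj (z0 $ j)"]
      by linarith
  qed
  have cpoint_\<xi>: "cpoint (\<xi> (vec_nth z) w) = z" for z w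
    by (simp add: cpoint_def \<xi>_def Finite_Cartesian_Product.vec_eq_iff field_simps)
  have cpoint_cnj_\<xi>: "cpoint (\<lambda>k. cnj (\<xi> z w k)) = (\<chi> j. cnj (w j))" for z w
    by (simp add: cpoint_def \<xi>_def Finite_Cartesian_Product.vec_eq_iff field_simps)
  define z1 where "z1 j = complex_of_real (u (Some (Inl j))) + \<i> * of_real (u (Some (Inr j)))" for j
  have \<xi>1: "\<xi> z1 (\<lambda>j. cnj (z1 j)) = (\<lambda>k. of_real (u (Some k)))"
    by (auto simp: \<xi>_def z1_def fun_eq_iff field_simps split: sum.split)
  define Q where "Q w = pc (case_option (of_real (u None)) (\<xi> z1 w))" for w
  have "polyfun Q"
    unfolding Q_def
  proof (rule polyfun_subst[OF pc(1)])
    fix i :: "('n + 'n) option"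
    show "polyfun (\<lambda>w. case i of None \<Rightarrow> of_real (u None) | Some k \<Rightarrow> \<xi> z1 w k)"
    proof (cases i)
      case (Some k)
      then show ?thesis
        by (cases k) (simp_all add: \<xi>_def, (intro polyfun_divide polyfun_intros)+)
    qed (simp add: polyfun_const)
  qed
  moreover have "Q (\<lambda>j. cnj (z1 j)) \<noteq> 0"
  proof -
    have "case_option (complex_of_real (u None)) (\<lambda>k. of_real (u (Some k))) = (\<lambda>i. of_real (u i))"
      by (auto split: option.split)
    then show ?thesis using U(5) by (simp add: Q_def \<xi>1 pc(2))
  qed
  moreover have "infinite (ball (cnj (z0 $ j)) (\<epsilon> / 4))" for j
    using uncountable_ball[of "\<epsilon> / 4" "cnj (z0 $ j)"] \<epsilon>(1) uncountable_infinite by auto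
  ultimately obtain w where w: "\<forall>j. w j \<in> ball (cnj (z0 $ j)) (\<epsilon> / 4)" "Q w \<noteq> 0"
    using polyfun_nonzero_in_box[of Q _ "\<lambda>j. ball (cnj (z0 $ j)) (\<epsilon> / 4)"] by blast
  define c where "c = cnj (f (\<chi> j. cnj (w j)))"
  define P where "P y = pc (case_option ((y None + c) / 2) (\<xi> (\<lambda>j. y (Some j)) w))" for y
  have "polyfun P"
    unfolding P_def
  proof (rule polyfun_subst[OF pc(1)])
    fix i :: "('n + 'n) option"
    show "polyfun (\<lambda>y. case i of None \<Rightarrow> (y None + c) / 2 | Some k \<Rightarrow> \<xi> (\<lambda>j. y (Some j)) w k)"
    proof (cases i)
      case None
      then show ?thesis by (simp, intro polyfun_divide polyfun_intros)
    next
      case (Some k)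
      then show ?thesis
        by (cases k) (simp_all add: \<xi>_def, (intro polyfun_divide polyfun_intros)+)
    qed
  qed
  moreover have "P (case_option (2 * of_real (u None) - c) z1) \<noteq> 0"
    using w(2) by (simp add: P_def Q_def)
  moreover have "P (case_option (f z) (vec_nth z)) = 0" if "z \<in> ball z0 (\<epsilon> / 4) \<inter> D" for z
  proof -
    have "norm (z $ j - z0 $ j) < \<epsilon> / 4" for j
    proof -
      have "norm ((z - z0) $ j) \<le> norm (z - z0)" by (rule Finite_Cartesian_Product.norm_nth_le)
      then show ?thesis using that by (simp add: dist_norm norm_minus_commute)
    qed
    moreover have "norm (w j - cnj (z0 $ j)) < \<epsilon> / 4" for j
      using w(1)[rule_format, of j] by (simp add: dist_norm norm_minus_commute)
    ultimately have "pc (case_option ((f (cpoint (\<xi> (vec_nth z) w))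
        + cnj (f (cpoint (\<lambda>k. cnj (\<xi> (vec_nth z) w k))))) / 2) (\<xi> (vec_nth z) w)) = 0"
      by (intro ident \<xi>_near)
    then show ?thesis by (simp add: cpoint_\<xi> cpoint_cnj_\<xi> P_def c_def)
  qed
  moreover have "holomorphic_several_on f (ball z0 (\<epsilon> / 4) \<inter> D)"
    using f by (rule holomorphic_several_on_subset) blast
  moreover have "open (ball z0 (\<epsilon> / 4) \<inter> D)" "z0 \<in> ball z0 (\<epsilon> / 4) \<inter> D" "ball z0 (\<epsilon> / 4) \<inter> D \<subseteq> D"
    using D z0 \<epsilon>(1) by auto
  ultimately show "nash_at holomorphic_several_on f D z0"
    unfolding nash_at_iff by blast
qed

lemma complex_nash_on_Re_iff:
  fixes f :: "complex ^ 'n::finite \<Rightarrow> complex"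
  assumes "open D" "holomorphic_several_on f D" "\<And>z. z \<in> D \<Longrightarrow> g z = Re (f z)"
  shows "complex_nash_on f D \<longleftrightarrow> real_nash_on (g \<circ> complexify) (complexify -` D)"
  using complex_nash_imp_real_nash[OF assms] real_nash_imp_complex_nash[OF assms] by blast

lemma complex_nash_on_cmult:
  fixes f :: "complex ^ 'n::finite \<Rightarrow> complex"
  assumes nash: "complex_nash_on f D" and c: "c \<noteq> 0"
  shows "complex_nash_on (\<lambda>z. c * f z) D"
  unfolding complex_nash_on_def
proof
  fix z0 assume "z0 \<in> D"
  with nash have "nash_at holomorphic_several_on f D z0" by (simp add: complex_nash_on_def)
  then obtain U p u where U: "open U" "z0 \<in> U" "U \<subseteq> D" "polyfun p" "p u \<noteq> 0"
    "holomorphic_several_on f U" "\<forall>z\<in>U. p (case_option (f z) (vec_nth z)) = 0"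
    unfolding nash_at_iff by blast
  define q where "q w = p (case_option (inverse c * w None) (\<lambda>j. w (Some j)))" for w
  have "polyfun q"
    unfolding q_def
  proof (rule polyfun_subst[OF U(4)])
    show "polyfun (\<lambda>w. case i of None \<Rightarrow> inverse c * w None | Some j \<Rightarrow> w (Some j))" for i
      by (cases i) (auto intro!: polyfun_intros)
  qed
  moreover have "q (case_option (c * u None) (\<lambda>j. u (Some j))) \<noteq> 0"
  proof -
    have "case_option (u None) (\<lambda>j. u (Some j)) = u" by (auto split: option.split)
    then show ?thesis using c U(5) by (simp add: q_def flip: mult.assoc)
  qed
  moreover have "\<forall>z\<in>U. q (case_option (c * f z) (vec_nth z)) = 0"
    using U(7) c by (simp add: q_def flip: mult.assoc)
  ultimately show "nash_at holomorphic_several_on (\<lambda>z. c * f z) D z0"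
    unfolding nash_at_iff using U(1-3) holomorphic_several_on_cmult[OF U(6)] by blast
qed

theorem corollary1p4:
  fixes D :: "(complex ^ 'n::finite) set"
    and f :: "complex ^ 'n \<Rightarrow> complex"
    and f1 f2 :: "complex ^ 'n \<Rightarrow> real"
  assumes "open D"
    and "holomorphic_several_on f D"
    and "\<And>z. z \<in> D \<Longrightarrow> f z = complex_of_real (f1 z) + \<i> * complex_of_real (f2 z)"
  shows "(complex_nash_on f D \<longleftrightarrow> real_nash_on (f1 \<circ> complexify) (complexify -` D)) \<and>
         (complex_nash_on f D \<longleftrightarrow> real_nash_on (f2 \<circ> complexify) (complexify -` D))"
proof
  show "complex_nash_on f D \<longleftrightarrow> real_nash_on (f1 \<circ> complexify) (complexify -` D)"
    by (rule complex_nash_on_Re_iff[OF assms(1,2)]) (simp add: assms(3))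
  have "complex_nash_on f D \<longleftrightarrow> complex_nash_on (\<lambda>z. - \<i> * f z) D"
  proof
    assume "complex_nash_on (\<lambda>z. - \<i> * f z) D"
    from complex_nash_on_cmult[OF this, of \<i>] show "complex_nash_on f D"
      by (simp flip: mult.assoc)
  qed (rule complex_nash_on_cmult, auto)
  also have "\<dots> \<longleftrightarrow> real_nash_on (f2 \<circ> complexify) (complexify -` D)"
    by (rule complex_nash_on_Re_iff[OF assms(1) holomorphic_several_on_cmult[OF assms(2)]]) (simp add: assms(3))
  finally show "complex_nash_on f D \<longleftrightarrow> real_nash_on (f2 \<circ> complexify) (complexify -` D)" .
qed

end
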